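(* Let $t=m\tau$ be a discrete time with $t+\tau\le T$, let $(U(t),W(t))$ be the coefficient vectors of a solution of the fully implicit scheme at time $t$, let $(\phi_N,\psi_N)$ be the pair of functions corresponding to the solution at time $t+\tau$, and let $\phi_N^{(k)},\psi_N^{(k)}$, $k\ge0$, be the Chord iterates for this time step (all defined in the context). Let $c_1,\epsilon_{tol1},\epsilon_{tol2}>0$ and assume that $\psi_N^{(0)}$ and $\phi_N^{(0)}$ are chosen such that $\|\phi_N-\phi_N^{(0)}\|_2<c_1$ and, for some $k_0\ge0$ and all $k\ge k_0$, $$\|\phi_N^{(k+1)}-\phi_N^{(k)}\|_2<\epsilon_{tol1}\qquad\text{and}\qquad\|\psi_N^{(k+1)}-\psi_N^{(k)}\|_2<\epsilon_{tol2}.$$ Let $$D_2:=D_2(\Omega,T,p,w_0)=c_{inv}^2\left(4c_1+\epsilon_{tol1}+\epsilon_{tol2}+e^{3T\|p\|_{1,\infty}}\|w_0\|_2\right)+2\|p\|_{1,\infty},$$ where $c_{inv}>0$ is a constant such that $|v|_{1,4}\le c_{inv}h^{-5/4}\|v\|_2$ for all $v\in X_N$. If $h<1$ and $$0<\tau\le\min\left\{\frac{1}{6\|p\|_{1,\infty}},\ \frac{h^2}{16\,c_{0,inv}\|W(t)\|_M},\ \frac{h^{5/2}}{D_2}\right\}=O(h^{2.5}),$$ then Chord's method converges to the unique solution $(U(t+\tau),W(t+\tau))$ of the fully implicit scheme at time $t+\tau$, i.e. $$\lim_{k\to\infty}\phi_N^{(k)}=\phi_N\qquad\text{and}\qquad\lim_{k\to\infty}\psi_N^{(k)}=\psi_N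 .$$
   Context: $\Omega=(0,L)^2$; $\langle\cdot,\cdot\rangle_2$, $\|\cdot\|_2$ are the $L^2(\Omega)$ inner product and norm; $\langle u,v\rangle_{H^1}=\langle u,v\rangle_2+\langle\nabla u,\nabla v\rangle_2$, with norm $\|\cdot\|_{H^1}$; $|v|_{1,4}=\left(\int_\Omega|\nabla v|^4\right)^{1/4}$. For a function $u$, $\vec V(u)=(-u_y,u_x)$. $p\in W^{1,\infty}(\Omega)$ is given, $\|p\|_{1,\infty}=\max\{\|p\|_{L^\infty},\|p_x\|_{L^\infty},\|p_y\|_{L^\infty}\}$ (with $1/0=+\infty$). $T>0$ is fixed. $w_0=u_0-\Delta u_0\in L^2(\Omega)$, where $u_0\in H^2(\Omega)\cap H^1_P$ is given and $H^1_P$ is the space of $H^1(\Omega)$ functions that are periodic. Finite elements: $\overline\Omega$ is covered by an $n\times n$ tensor grid of nodes and a conforming structured triangulation based on it, with mesh size $h$. $X_N$ is the space of continuous functions on $\overline\Omega$ that are affine on each triangle; $X_{N,P}\subset X_N$ is the subspace of functions satisfying periodic boundary conditions, of dimension $N=(n-1)^2$, with nodal basis $\varphi_1,\dots,\varphi_N$. $c_{0,inv}>0$ is a constant such that $\|v\|_{H^1}\le\frac{c_{0,inv}}{h}\|v\|_2$ for all $v\in X_N$. $N\times N$ matrices: $M_{I,J}=\langle\varphi_I,\varphi_J\rangle_2$, $K_{I,J}=\langle\varphi_I,\varphi_J\rangle_{H^1}$, $R_{I,J}=\langle\vec V(p)\cdot\nabla\varphi_J,\varphi_I\rangle_2$;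 for $U\in\mathbb{R}^N$, $S_{I,J}(U)=-\langle\vec V(\sum_LU_L\varphi_L)\cdot\nabla\varphi_I,\varphi_J\rangle_2$; for $W\in\mathbb{R}^N$, $B(W)=[\,S(e_1)W\ \ S(e_2)W\ \cdots\ S(e_N)W\,]$ with $e_j$ the canonical basis of $\mathbb{R}^N$. $\|a\|_M^2=a^TMa$. Fully implicit scheme: $W(0)$ is the coefficient vector of the $L^2$ projection of $w_0$ onto $X_{N,P}$, $KU(0)=MW(0)$, and for each discrete time $t=m\tau$ with $t+\tau\le T$, $(M+\tau S(U(t+\tau)))W(t+\tau)-\tau RU(t+\tau)=MW(t)$ and $KU(s)=MW(s)$ for $s\in\{t,t+\tau\}$. It is known (earlier work) that, given $(U(t),W(t))$, this system has a unique solution $(U(t+\tau),W(t+\tau))$ when $\tau\le\min\{\frac{1}{2\|p\|_{1,\infty}},\frac{h^2}{16c_{0,inv}\|W(t)\|_M}\}$. Put $\phi_N=\sum_IU_I(t+\tau)\varphi_I$, $\psi_N=\sum_IW_I(t+\tau)\varphi_I$. Chord's method: $(U^{(0)},W^{(0)})=(U(t),W(t))$ and, for $k\ge0$, $(U^{(k+1)},W^{(k+1)})$ solves $$\begin{bmatrix}\tau B(W^{(0)})-\tau R&M+\tau S(U^{(0)})\\ K&-M\end{bmatrix}\begin{bmatrix}U^{(k+1)}\\ W^{(k+1)}\end{bmatrix}=\begin{bmatrix}\tau S(U^{(k)})W^{(0)}+\tau S(U^{(0)})W^{(k)}-\tau S(U^{(k)})W^{(k)}+MW(t)\\ 0\end{bmatrix}.$$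 $\phi_N^{(k)}=\sum_IU^{(k)}_I\varphi_I$ and $\psi_N^{(k)}=\sum_IW^{(k)}_I\varphi_I$. *)

theory Defs
  imports "HOL-Analysis.Analysis" "HOL-Probability.Essential_Supremum"
begin

section \<open>Lebesgue and Sobolev spaces on the square\<close>

type_synonym plane = "real \<times> real"

definition Omega :: "real \<Rightarrow> plane set" where
  "Omega L = {0<..<L} \<times> {0<..<L}"

definition Omega_bar :: "real \<Rightarrow> plane set" where
  "Omega_bar L = {0..L} \<times> {0..L}"

definition L2_space :: "real \<Rightarrow> (plane \<Rightarrow> real) set" where
  "L2_space L = {f. f \<in> borel_measurable (lebesgue_on (Omega L)) \<and>
                    integrable (lebesgue_on (Omega L)) (\<lambda>z. (f z)\<^sup>2)}"

definition ip2 :: "real \<Rightarrow> (plane \<Rightarrow> real) \<Rightarrow> (plane \<Rightarrow> real) \<Rightarrow> real" where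
  "ip2 L f g = (LINT z|lebesgue_on (Omega L). f z * g z)"

definition norm2 :: "real \<Rightarrow> (plane \<Rightarrow> real) \<Rightarrow> real" where
  "norm2 L f = sqrt (ip2 L f f)"

definition Linf_space :: "real \<Rightarrow> (plane \<Rightarrow> real) set" where
  "Linf_space L = {f. f \<in> borel_measurable (lebesgue_on (Omega L)) \<and>
                      (\<exists>C. AE z in lebesgue_on (Omega L). \<bar>f z\<bar> \<le> C)}"

definition norm_inf :: "real \<Rightarrow> (plane \<Rightarrow> real) \<Rightarrow> real" where
  "norm_inf L f = real_of_ereal (esssup (lebesgue_on (Omega L)) (\<lambda>z. ereal \<bar>f z\<bar>))"

text \<open>Classical partial derivative in direction \<open>e\<close>; the value is meaningful only where it exists.\<close>

definition partial :: "plane \<Rightarrow> (plane \<Rightarrow> real) \<Rightarrow> plane \<Rightarrow> real" where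
  "partial e f z = deriv (\<lambda>s. f (z + s *\<^sub>R e)) 0"

text \<open>A function is \<open>C\<^sup>\<infinity>\<close> iff every iterated partial derivative is (Frechet) differentiable.
  Note that \<open>Basis = {(1, 0), (0, 1)}\<close> here.\<close>

definition smooth :: "(plane \<Rightarrow> real) \<Rightarrow> bool" where
  "smooth f \<longleftrightarrow> (\<forall>es. set es \<subseteq> Basis \<longrightarrow> foldr partial es f differentiable_on UNIV)"

definition test_functions :: "plane set \<Rightarrow> (plane \<Rightarrow> real) set" where
  "test_functions D = {f. smooth f \<and> compact (closure {z. f z \<noteq> 0}) \<and> closure {z. f z \<noteq> 0} \<subseteq> D}"

definition locally_integrable :: "plane set \<Rightarrow> (plane \<Rightarrow> real) \<Rightarrow> bool" where
  "locally_integrable D f \<longleftrightarrow> (\<forall>K. compact K \<and> K \<subseteq> D \<longrightarrow> f absolutely_integrable_on K)"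

text \<open>\<open>q\<close> is a distributional gradient of \<open>u\<close> on the open set \<open>D\<close>.\<close>

definition weak_gradient :: "plane set \<Rightarrow> (plane \<Rightarrow> real) \<Rightarrow> (plane \<Rightarrow> plane) \<Rightarrow> bool" where
  "weak_gradient D u q \<longleftrightarrow> locally_integrable D u \<and>
     (\<forall>e\<in>Basis. locally_integrable D (\<lambda>z. q z \<bullet> e) \<and>
        (\<forall>f\<in>test_functions D.
           (LINT z|lebesgue_on D. u z * partial e f z) = - (LINT z|lebesgue_on D. (q z \<bullet> e) * f z)))"

text \<open>\<open>p\<close> belongs to \<open>W\<^sup>1\<^sup>,\<^sup>\<infinity>(\<Omega>)\<close>, with \<open>q\<close> a version of its weak gradient.\<close>

definition W1inf_with_gradient :: "real \<Rightarrow> (plane \<Rightarrow> real) \<Rightarrow> (plane \<Rightarrow> plane) \<Rightarrow> bool" where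
  "W1inf_with_gradient L p q \<longleftrightarrow> p \<in> Linf_space L \<and> weak_gradient (Omega L) p q \<and>
     (\<lambda>z. fst (q z)) \<in> Linf_space L \<and> (\<lambda>z. snd (q z)) \<in> Linf_space L"

definition norm_1inf :: "real \<Rightarrow> (plane \<Rightarrow> real) \<Rightarrow> (plane \<Rightarrow> plane) \<Rightarrow> real" where
  "norm_1inf L p q =
     max (norm_inf L p) (max (norm_inf L (\<lambda>z. fst (q z))) (norm_inf L (\<lambda>z. snd (q z))))"

definition H1_space :: "real \<Rightarrow> (plane \<Rightarrow> real) set" where
  "H1_space L = {u \<in> L2_space L. \<exists>q. weak_gradient (Omega L) u q \<and>
                                     (\<forall>e\<in>Basis. (\<lambda>z. q z \<bullet> e) \<in> L2_space L)}"

definition H2_space :: "real \<Rightarrow> (plane \<Rightarrow> real) set" where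
  "H2_space L = {u \<in> L2_space L. \<exists>q. weak_gradient (Omega L) u q \<and>
                                     (\<forall>e\<in>Basis. (\<lambda>z. q z \<bullet> e) \<in> H1_space L)}"

text \<open>Periodicity of an \<open>H\<^sup>1\<close> function, i.e. equality of its traces on opposite sides,
  is expressed by requiring the periodic extension to be in \<open>H\<^sup>1\<close> locally on the whole plane.\<close>

definition H1P_space :: "real \<Rightarrow> (plane \<Rightarrow> real) set" where
  "H1P_space L = {u \<in> H1_space L. \<exists>v q.
      (\<forall>z. v (z + (L, 0)) = v z \<and> v (z + (0, L)) = v z) \<and>
      (AE z in lebesgue_on (Omega L). v z = u z) \<and>
      weak_gradient UNIV v q \<and>
      locally_integrable UNIV (\<lambda>z. (v z)\<^sup>2) \<and>
      (\<forall>e\<in>Basis. locally_integrable UNIV (\<lambda>z. (q z \<bullet> e)\<^sup>2))}"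

definition weak_laplacian :: "plane set \<Rightarrow> (plane \<Rightarrow> real) \<Rightarrow> (plane \<Rightarrow> real) \<Rightarrow> bool" where
  "weak_laplacian D u f \<longleftrightarrow> (\<exists>q r. weak_gradient D u q \<and>
      (\<forall>e\<in>Basis. weak_gradient D (\<lambda>z. q z \<bullet> e) (r e)) \<and>
      f = (\<lambda>z. \<Sum>e\<in>Basis. r e z \<bullet> e))"

section \<open>Gradients of finite element functions\<close>

text \<open>For continuous piecewise affine functions the classical gradient exists off the edges of the
  triangulation, a null set, and there it coincides with the weak gradient.\<close>

definition grad :: "(plane \<Rightarrow> real) \<Rightarrow> plane \<Rightarrow> plane" where
  "grad u z = (partial (1, 0) u z, partial (0, 1) u z)"

text \<open>\<open>V(u) = rot90 (grad u)\<close>.\<close>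

definition rot90 :: "plane \<Rightarrow> plane" where
  "rot90 g = (- snd g, fst g)"

definition ipH1 :: "real \<Rightarrow> (plane \<Rightarrow> real) \<Rightarrow> (plane \<Rightarrow> real) \<Rightarrow> real" where
  "ipH1 L u v = ip2 L u v + (LINT z|lebesgue_on (Omega L). grad u z \<bullet> grad v z)"

definition normH1 :: "real \<Rightarrow> (plane \<Rightarrow> real) \<Rightarrow> real" where
  "normH1 L u = sqrt (ipH1 L u u)"

definition seminorm_14 :: "real \<Rightarrow> (plane \<Rightarrow> real) \<Rightarrow> real" where
  "seminorm_14 L v = root 4 (LINT z|lebesgue_on (Omega L). norm (grad v z) ^ 4)"

section \<open>Triangulation and finite element spaces\<close>

text \<open>The \<open>n\<close> nodes per direction are \<open>x 0 < \<dots> < x (n - 1)\<close>.\<close>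

definition grid_points :: "real \<Rightarrow> nat \<Rightarrow> (nat \<Rightarrow> real) \<Rightarrow> bool" where
  "grid_points L n x \<longleftrightarrow> 2 \<le> n \<and> x 0 = 0 \<and> x (n - 1) = L \<and> strict_mono_on {..<n} x"

text \<open>The cell with lower left node \<open>(i, j)\<close> is cut into two triangles along the diagonal through
  that node if \<open>d i j\<close>, and along the other diagonal otherwise. Arbitrary \<open>d\<close> covers every
  structured pattern.\<close>

definition cell_triangles ::
  "(nat \<Rightarrow> real) \<Rightarrow> (nat \<Rightarrow> real) \<Rightarrow> (nat \<Rightarrow> nat \<Rightarrow> bool) \<Rightarrow> nat \<Rightarrow> nat \<Rightarrow> plane set set" where
  "cell_triangles x y d i j =
     (let a = (x i, y j); b = (x (Suc i), y j); c = (x (Suc i), y (Suc j)); e = (x i, y (Suc j))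
      in if d i j then {convex hull {a, b, c}, convex hull {a, c, e}}
         else {convex hull {a, b, e}, convex hull {b, c, e}})"

definition grid_triangulation ::
  "nat \<Rightarrow> (nat \<Rightarrow> real) \<Rightarrow> (nat \<Rightarrow> real) \<Rightarrow> (nat \<Rightarrow> nat \<Rightarrow> bool) \<Rightarrow> plane set set" where
  "grid_triangulation n x y d = (\<Union>i<n - 1. \<Union>j<n - 1. cell_triangles x y d i j)"

definition mesh_size :: "plane set set \<Rightarrow> real" where
  "mesh_size \<T> = Max (diameter ` \<T>)"

definition X_N :: "real \<Rightarrow> plane set set \<Rightarrow> (plane \<Rightarrow> real) set" where
  "X_N L \<T> = {v. continuous_on (Omega_bar L) v \<and>
                 (\<forall>t\<in>\<T>. \<exists>a b. \<forall>z\<in>t. v z = a + b \<bullet> z)}"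

definition X_NP :: "real \<Rightarrow> plane set set \<Rightarrow> (plane \<Rightarrow> real) set" where
  "X_NP L \<T> = {v \<in> X_N L \<T>. \<forall>s\<in>{0..L}. v (0, s) = v (L, s) \<and> v (s, 0) = v (s, L)}"

text \<open>The type \<open>'k\<close> enumerates, via \<open>\<nu>\<close>, the \<open>N = (n - 1)\<^sup>2\<close> nodes that remain after identifying
  opposite sides of the square.\<close>

definition nodal_basis ::
  "real \<Rightarrow> nat \<Rightarrow> (nat \<Rightarrow> real) \<Rightarrow> (nat \<Rightarrow> real) \<Rightarrow> plane set set \<Rightarrow>
   ('k::finite \<Rightarrow> nat \<times> nat) \<Rightarrow> ('k \<Rightarrow> plane \<Rightarrow> real) \<Rightarrow> bool" where
  "nodal_basis L n x y \<T> \<nu> \<phi> \<longleftrightarrow>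
     bij_betw \<nu> UNIV ({..<n - 1} \<times> {..<n - 1}) \<and>
     (\<forall>I. \<phi> I \<in> X_NP L \<T>) \<and>
     (\<forall>I J. \<phi> I (x (fst (\<nu> J)), y (snd (\<nu> J))) = (if I = J then 1 else 0))"

definition fe_fun :: "('k::finite \<Rightarrow> plane \<Rightarrow> real) \<Rightarrow> real ^ 'k \<Rightarrow> plane \<Rightarrow> real" where
  "fe_fun \<phi> U z = (\<Sum>I\<in>UNIV. U $ I * \<phi> I z)"

section \<open>Matrices\<close>

definition M_mat :: "real \<Rightarrow> ('k::finite \<Rightarrow> plane \<Rightarrow> real) \<Rightarrow> real ^ 'k ^ 'k" where
  "M_mat L \<phi> = (\<chi> I J. ip2 L (\<phi> I) (\<phi> J))"

definition K_mat :: "real \<Rightarrow> ('k::finite \<Rightarrow> plane \<Rightarrow> real) \<Rightarrow> real ^ 'k ^ 'k" where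
  "K_mat L \<phi> = (\<chi> I J. ipH1 L (\<phi> I) (\<phi> J))"

text \<open>Here \<open>q\<close> is the weak gradient of \<open>p\<close>.\<close>

definition R_mat ::
  "real \<Rightarrow> (plane \<Rightarrow> plane) \<Rightarrow> ('k::finite \<Rightarrow> plane \<Rightarrow> real) \<Rightarrow> real ^ 'k ^ 'k" where
  "R_mat L q \<phi> = (\<chi> I J. ip2 L (\<lambda>z. rot90 (q z) \<bullet> grad (\<phi> J) z) (\<phi> I))"

definition S_mat ::
  "real \<Rightarrow> ('k::finite \<Rightarrow> plane \<Rightarrow> real) \<Rightarrow> real ^ 'k \<Rightarrow> real ^ 'k ^ 'k" where
  "S_mat L \<phi> U =
     (\<chi> I J. - ip2 L (\<lambda>z. rot90 (grad (fe_fun \<phi> U) z) \<bullet> grad (\<phi> I) z) (\<phi> J))"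

definition B_mat ::
  "real \<Rightarrow> ('k::finite \<Rightarrow> plane \<Rightarrow> real) \<Rightarrow> real ^ 'k \<Rightarrow> real ^ 'k ^ 'k" where
  "B_mat L \<phi> W = (\<chi> I J. (S_mat L \<phi> (axis J 1) *v W) $ I)"

definition norm_M :: "real ^ 'k ^ 'k \<Rightarrow> real ^ 'k::finite \<Rightarrow> real" where
  "norm_M A a = sqrt (a \<bullet> (A *v a))"

definition block_mat ::
  "real ^ 'k ^ 'k \<Rightarrow> real ^ 'k ^ 'k \<Rightarrow> real ^ 'k ^ 'k \<Rightarrow> real ^ 'k ^ 'k
   \<Rightarrow> real ^ ('k::finite + 'k) ^ ('k + 'k)" where
  "block_mat A B C D = (\<chi> i j. case i of
      Inl I \<Rightarrow> (case j of Inl J \<Rightarrow> A $ I $ J | Inr J \<Rightarrow> B $ I $ J)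
    | Inr I \<Rightarrow> (case j of Inl J \<Rightarrow> C $ I $ J | Inr J \<Rightarrow> D $ I $ J))"

definition block_vec :: "real ^ 'k \<Rightarrow> real ^ 'k \<Rightarrow> real ^ ('k::finite + 'k)" where
  "block_vec u w = (\<chi> i. case i of Inl I \<Rightarrow> u $ I | Inr I \<Rightarrow> w $ I)"

section \<open>The fully implicit scheme and Chord's method\<close>

text \<open>\<open>(U', W')\<close> solves one step of size \<open>\<tau>\<close> from \<open>(U, W)\<close>.\<close>

definition implicit_step ::
  "real \<Rightarrow> (plane \<Rightarrow> plane) \<Rightarrow> ('k::finite \<Rightarrow> plane \<Rightarrow> real) \<Rightarrow> real \<Rightarrow>
   real ^ 'k \<Rightarrow> real ^ 'k \<Rightarrow> real ^ 'k \<Rightarrow> real ^ 'k \<Rightarrow> bool" where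
  "implicit_step L q \<phi> \<tau> U W U' W' \<longleftrightarrow>
     (M_mat L \<phi> + \<tau> *\<^sub>R S_mat L \<phi> U') *v W' - \<tau> *\<^sub>R (R_mat L q \<phi> *v U') = M_mat L \<phi> *v W \<and>
     K_mat L \<phi> *v U = M_mat L \<phi> *v W \<and>
     K_mat L \<phi> *v U' = M_mat L \<phi> *v W'"

text \<open>\<open>(U j, W j)\<close> stands for the pair at time \<open>j \<tau>\<close>; the scheme is imposed for the first \<open>m\<close> steps.
  The first conjunct says that \<open>W 0\<close> is the coefficient vector of the orthogonal projection of \<open>w0\<close>.\<close>

definition implicit_solution ::
  "real \<Rightarrow> (plane \<Rightarrow> plane) \<Rightarrow> plane set set \<Rightarrow> ('k::finite \<Rightarrow> plane \<Rightarrow> real) \<Rightarrow> real \<Rightarrow>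
   (plane \<Rightarrow> real) \<Rightarrow> nat \<Rightarrow> (nat \<Rightarrow> real ^ 'k) \<Rightarrow> (nat \<Rightarrow> real ^ 'k) \<Rightarrow> bool" where
  "implicit_solution L q \<T> \<phi> \<tau> w0 m U W \<longleftrightarrow>
     (\<forall>v\<in>X_NP L \<T>. ip2 L (fe_fun \<phi> (W 0)) v = ip2 L w0 v) \<and>
     K_mat L \<phi> *v U 0 = M_mat L \<phi> *v W 0 \<and>
     (\<forall>j<m. implicit_step L q \<phi> \<tau> (U j) (W j) (U (Suc j)) (W (Suc j)))"

definition chord_iterates ::
  "real \<Rightarrow> (plane \<Rightarrow> plane) \<Rightarrow> ('k::finite \<Rightarrow> plane \<Rightarrow> real) \<Rightarrow> real \<Rightarrow>
   real ^ 'k \<Rightarrow> real ^ 'k \<Rightarrow> (nat \<Rightarrow> real ^ 'k) \<Rightarrow> (nat \<Rightarrow> real ^ 'k) \<Rightarrow> bool" where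
  "chord_iterates L q \<phi> \<tau> Ut Wt Uc Wc \<longleftrightarrow> Uc 0 = Ut \<and> Wc 0 = Wt \<and>
     (\<forall>k. block_mat (\<tau> *\<^sub>R B_mat L \<phi> (Wc 0) - \<tau> *\<^sub>R R_mat L q \<phi>)
                    (M_mat L \<phi> + \<tau> *\<^sub>R S_mat L \<phi> (Uc 0))
                    (K_mat L \<phi>) (- M_mat L \<phi>) *v block_vec (Uc (Suc k)) (Wc (Suc k)) =
          block_vec (\<tau> *\<^sub>R (S_mat L \<phi> (Uc k) *v Wc 0) + \<tau> *\<^sub>R (S_mat L \<phi> (Uc 0) *v Wc k)
                       - \<tau> *\<^sub>R (S_mat L \<phi> (Uc k) *v Wc k) + M_mat L \<phi> *v Wt) 0)"

end

theory Submission
  imports Defs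
begin

text \<open>The error \<open>\<epsilon>\<^sub>k\<close> of the iterate \<open>\<psi>\<^sup>(\<^sup>k\<^sup>)\<close> satisfies an equation in which every convection term is of the form
  \<open>s(e; a, b) = \<integral> (V(e) \<bullet> \<nabla>a) b\<close> with \<open>e\<close> the elliptic potential of a known function \<open>f\<close>, i.e. \<open>K e = M f\<close>.
  Testing that equation with \<open>e\<close> gives \<open>\<parallel>\<nabla>e\<parallel> \<le> \<parallel>f\<parallel> / 2\<close>. Since \<open>\<nabla>e\<close> is piecewise constant, its \<open>L\<^sup>4\<close> norm
  is bounded by its \<open>L\<^sup>2\<close> norm and the area of the triangle on which \<open>|\<nabla>e|\<close> is largest, and the inverse
  inequality, applied to a nodal hat function, bounds that area from below. Altogether
  \<open>|s(e; a, b)| \<le> 5/12 c\<^sub>i\<^sub>n\<^sub>v\<^sup>2 h powr (-5/2) \<parallel>f\<parallel> \<parallel>a\<parallel> \<parallel>b\<parallel>\<close>. The gain of the factor \<open>5/12\<close> over the plain Hoelder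
  estimate makes \<open>\<epsilon>\<^sub>k \<mapsto> \<epsilon>\<^sub>k\<^sub>+\<^sub>1\<close> a contraction with factor \<open>9/10\<close>, starting from the exact increment
  \<open>\<psi>\<^sup>(\<^sup>0\<^sup>) - \<psi>\<close>, which the implicit scheme controls. The a priori bound \<open>exp (3 T \<parallel>p\<parallel>) \<parallel>w0\<parallel>\<close> for the implicit
  solution follows from the skew symmetry \<open>s(u; a, a) = 0\<close>.\<close>

section \<open>Integrals over right triangles\<close>

text \<open>The integral of \<open>(f x + s * g x)\<^sup>2\<close> is a nonnegative polynomial in
  \<open>s\<close>; its value at the minimiser gives the inequality.\<close>

lemma Cauchy_Schwarz_L2:
  fixes f g :: "'a \<Rightarrow> real"
  assumes f: "f \<in> borel_measurable M" "integrable M (\<lambda>x. (f x)\<^sup>2)"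
    and g: "g \<in> borel_measurable M" "integrable M (\<lambda>x. (g x)\<^sup>2)"
  shows "integrable M (\<lambda>x. f x * g x)"
    and "\<bar>LINT x|M. f x * g x\<bar> \<le> sqrt (LINT x|M. (f x)\<^sup>2) * sqrt (LINT x|M. (g x)\<^sup>2)"
proof -
  show int: "integrable M (\<lambda>x. f x * g x)"
  proof (rule Bochner_Integration.integrable_bound)
    show "integrable M (\<lambda>x. (f x)\<^sup>2 + (g x)\<^sup>2)" using f(2) g(2) by simp
    show "(\<lambda>x. f x * g x) \<in> borel_measurable M" using f(1) g(1) by measurable
    have "\<bar>f x * g x\<bar> \<le> (f x)\<^sup>2 + (g x)\<^sup>2" for x
    proof -
      have "2 * \<bar>f x\<bar> * \<bar>g x\<bar> \<le> \<bar>f x\<bar>\<^sup>2 + \<bar>g x\<bar>\<^sup>2" by (rule sum_squares_bound)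
      moreover have "0 \<le> \<bar>f x\<bar> * \<bar>g x\<bar>" by simp
      ultimately show ?thesis unfolding abs_mult power2_abs mult.assoc by linarith
    qed
    then show "AE x in M. norm (f x * g x) \<le> norm ((f x)\<^sup>2 + (g x)\<^sup>2)" by simp
  qed
  define A B C where "A = (LINT x|M. (f x)\<^sup>2)" and "B = (LINT x|M. f x * g x)" and "C = (LINT x|M. (g x)\<^sup>2)"
  have nn: "0 \<le> A" "0 \<le> C" unfolding A_def C_def by simp_all
  have quad: "0 \<le> A + 2 * s * B + s\<^sup>2 * C" for s
  proof -
    have "0 \<le> (LINT x|M. (f x + s * g x)\<^sup>2)" by simp
    also have "\<dots> = (LINT x|M. (f x)\<^sup>2 + 2 * s * (f x * g x) + s\<^sup>2 * (g x)\<^sup>2)"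
      by (simp add: power2_sum power_mult_distrib algebra_simps)
    also have "\<dots> = A + 2 * s * B + s\<^sup>2 * C"
      unfolding A_def B_def C_def using f(2) g(2) int by simp
    finally show ?thesis .
  qed
  have "B\<^sup>2 \<le> A * C"
  proof (cases "C = 0")
    case True
    have "B = 0"
    proof (rule ccontr)
      assume "B \<noteq> 0"
      \<comment> \<open>With \<open>C = 0\<close> the polynomial is affine in \<open>s\<close>, and
        this argument makes it equal to \<open>-1\<close>.\<close>
      then show False using quad[of "- (A + 1) / (2 * B)"] True nn by (simp add: field_simps)
    qed
    then show ?thesis using True by simp
  next
    case False
    then have "0 < C" using nn by simp
    have "0 \<le> A + 2 * (- B / C) * B + (- B / C)\<^sup>2 * C" by (rule quad)
    also have "\<dots> = A - B\<^sup>2 / C" using \<open>0 < C\<close> by (simp add: field_simps power2_eq_square)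
    finally show ?thesis using \<open>0 < C\<close> by (simp add: field_simps)
  qed
  then have "sqrt (B\<^sup>2) \<le> sqrt (A * C)" by (rule real_sqrt_le_mono)
  then show "\<bar>LINT x|M. f x * g x\<bar> \<le> sqrt (LINT x|M. (f x)\<^sup>2) * sqrt (LINT x|M. (g x)\<^sup>2)"
    unfolding A_def B_def C_def by (simp add: real_sqrt_mult)
qed

text \<open>The open right triangle with its right angle at \<open>P\<close> and legs along the
  axes. Dividing by signed legs covers all four orientations at once; a zero leg gives the empty
  set, since division by zero is zero.\<close>

definition rtri :: "plane \<Rightarrow> real \<Rightarrow> real \<Rightarrow> plane set" where
  "rtri P a b = {z. 0 < (fst z - fst P) / a \<and> 0 < (snd z - snd P) / b \<and>
                    (fst z - fst P) / a + (snd z - snd P) / b < 1}"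

lemma open_rtri: "open (rtri P a b)"
proof -
  have "rtri P a b = {z. 0 < (fst z - fst P) * (1/a)} \<inter> {z. 0 < (snd z - snd P) * (1/b)} \<inter>
           {z. (fst z - fst P) * (1/a) + (snd z - snd P) * (1/b) < 1}"
    by (auto simp: rtri_def)
  also have "open \<dots>"
    by (intro open_Int open_Collect_less continuous_intros)
  finally show ?thesis .
qed

lemma rtri_subset_cbox:
  assumes "a \<noteq> 0" "b \<noteq> 0"
  shows "rtri P a b \<subseteq> cbox (P - (\<bar>a\<bar>, \<bar>b\<bar>)) (P + (\<bar>a\<bar>, \<bar>b\<bar>))"
proof
  fix z assume z: "z \<in> rtri P a b"
  have aux: "\<bar>t\<bar> \<le> \<bar>c\<bar>" if "0 < t / c" "t / c < 1" for t c :: real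
  proof -
    have "\<bar>t\<bar> / \<bar>c\<bar> < 1" using that by (metis abs_divide abs_of_pos)
    moreover have "c \<noteq> 0" using that by auto
    ultimately show ?thesis by (simp add: field_simps)
  qed
  have "\<bar>fst z - fst P\<bar> \<le> \<bar>a\<bar>" "\<bar>snd z - snd P\<bar> \<le> \<bar>b\<bar>"
    using z by (auto simp: rtri_def intro!: aux)
  then show "z \<in> cbox (P - (\<bar>a\<bar>, \<bar>b\<bar>)) (P + (\<bar>a\<bar>, \<bar>b\<bar>))"
    by (cases z, cases P) (auto simp: mem_box Basis_prod_def abs_le_iff)
qed

text \<open>Agreement with \<open>g\<close> is asked only inside the open triangle, because the
  classical gradient of a finite element function has no controlled value on the edges.\<close>

lemma set_integrable_rtri:
  fixes g :: "plane \<Rightarrow> real"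
  assumes "a \<noteq> 0" "b \<noteq> 0" "continuous_on UNIV g" "\<And>z. z \<in> rtri P a b \<Longrightarrow> f z = g z"
  shows "set_integrable lebesgue (rtri P a b) f"
proof -
  let ?c = "cbox (P - (\<bar>a\<bar>, \<bar>b\<bar>)) (P + (\<bar>a\<bar>, \<bar>b\<bar>))"
  have "g absolutely_integrable_on ?c"
    by (rule absolutely_integrable_continuous) (use assms(3) continuous_on_subset in blast)
  then have "set_integrable lebesgue (rtri P a b) g"
    by (rule set_integrable_subset) (use rtri_subset_cbox[OF assms(1,2)] open_rtri in auto)
  then show ?thesis
    by (subst set_integrable_cong) (use assms(4) in auto)
qed

lemma LBINT_quadratic:
  fixes c0 c1 c2 b :: real
  assumes "0 \<le> b"
  shows "(LINT t:{0<..<b}|lborel. c0 + c1 * t + c2 * t\<^sup>2) = c0 * b + c1 * b\<^sup>2 / 2 + c2 * b^3 / 3"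
proof -
  have "(LINT t:{0<..<b}|lborel. c0 + c1 * t + c2 * t\<^sup>2) = (LBINT t=ereal 0..ereal b. c0 + c1 * t + c2 * t\<^sup>2)"
    using assms by (simp add: interval_lebesgue_integral_def)
  also have "\<dots> = (\<lambda>t. c0 * t + c1 * t\<^sup>2 / 2 + c2 * t^3 / 3) b - (\<lambda>t. c0 * t + c1 * t\<^sup>2 / 2 + c2 * t^3 / 3) 0"
  proof (rule interval_integral_FTC_finite)
    show "continuous_on {min 0 b..max 0 b} (\<lambda>t. c0 + c1 * t + c2 * t\<^sup>2)" by (intro continuous_intros)
    show "((\<lambda>t. c0 * t + c1 * t\<^sup>2 / 2 + c2 * t^3 / 3) has_vector_derivative c0 + c1 * t + c2 * t\<^sup>2)
        (at t within {min 0 b..max 0 b})" for t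
      unfolding has_real_derivative_iff_has_vector_derivative[symmetric]
      by (auto intro!: derivative_eq_intros simp: power2_eq_square)
  qed
  finally show ?thesis by simp
qed

text \<open>Fubini: the slice at first coordinate \<open>s\<close> is \<open>{0<..<1 - s}\<close>,
  so the inner integral is a quadratic polynomial in \<open>s\<close>.\<close>

lemma standard_triangle_integral:
  fixes A B C :: real
  shows "(LINT z:rtri 0 1 1|lborel. A + B * fst z + C * snd z) = A / 2 + B / 6 + C / 6"
proof -
  let ?f = "\<lambda>s t. indicator (rtri 0 1 1) (s, t) *\<^sub>R (A + B * s + C * t)"
  have gm: "(\<lambda>z. indicator (rtri 0 1 1) z *\<^sub>R (A + B * fst z + C * snd z)) \<in> borel_measurable borel"
    by (intro borel_measurable_scaleR borel_measurable_indicator borel_open open_rtri)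
       (simp_all add: borel_measurable_continuous_onI continuous_intros)
  have "set_integrable lebesgue (rtri 0 1 1) (\<lambda>z. A + B * fst z + C * snd z)"
    by (rule set_integrable_rtri[where g="\<lambda>z. A + B * fst z + C * snd z"])
       (auto intro!: continuous_intros)
  then have int: "integrable lborel (\<lambda>z. indicator (rtri 0 1 1) z *\<^sub>R (A + B * fst z + C * snd z))"
    unfolding set_integrable_def
    by (subst (asm) integrable_completion) (use gm in simp_all)
  have feq: "(\<lambda>(s, t). ?f s t) = (\<lambda>z. indicator (rtri 0 1 1) z *\<^sub>R (A + B * fst z + C * snd z))"
    by (auto simp: fun_eq_iff)
  from int have int2: "integrable (lborel \<Otimes>\<^sub>M lborel) (\<lambda>(s, t). ?f s t)"
    unfolding lborel_prod feq .
  have inner: "(LINT t|lborel. ?f s t) = indicator {0<..<1} s *\<^sub>R ((A + C/2) + (B - A - C) * s + (C/2 - B) * s\<^sup>2)" for s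
  proof (cases "0 < s \<and> s < 1")
    case True
    have "(LINT t|lborel. ?f s t) = (LINT t:{0<..<1-s}|lborel. (A + B * s) + C * t + 0 * t\<^sup>2)"
      unfolding set_lebesgue_integral_def
      by (rule Bochner_Integration.integral_cong) (use True in \<open>auto simp: indicator_def rtri_def\<close>)
    also have "\<dots> = (A + B * s) * (1 - s) + C * (1 - s)\<^sup>2 / 2 + 0 * (1-s)^3/3"
      by (rule LBINT_quadratic) (use True in auto)
    also have "\<dots> = (A + C/2) + (B - A - C) * s + (C/2 - B) * s\<^sup>2"
      by (simp add: power2_eq_square field_simps)
    finally show ?thesis using True by simp
  next
    case False
    have "(LINT t|lborel. ?f s t) = (LINT t|(lborel :: real measure). (0::real))"
      by (rule Bochner_Integration.integral_cong) (use False in \<open>auto simp: indicator_def rtri_def\<close>)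
    then show ?thesis using False by (auto simp: indicator_def)
  qed
  have "(LINT z:rtri 0 1 1|lborel. A + B * fst z + C * snd z) = integral\<^sup>L (lborel \<Otimes>\<^sub>M lborel) (\<lambda>(s, t). ?f s t)"
    by (simp only: set_lebesgue_integral_def lborel_prod feq)
  also have "\<dots> = (LINT s|lborel. LINT t|lborel. ?f s t)"
    by (rule lborel_pair.integral_fst[OF int2, symmetric])
  also have "\<dots> = (LINT s:{0<..<1}|lborel. (A + C/2) + (B - A - C) * s + (C/2 - B) * s\<^sup>2)"
    by (simp only: inner set_lebesgue_integral_def)
  also have "\<dots> = A / 2 + B / 6 + C / 6"
    by (subst LBINT_quadratic) (auto simp: field_simps)
  finally show ?thesis .
qed

text \<open>An affine change of variables with Jacobian \<open>\<bar>a * b\<bar>\<close> reduces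
  this to the standard triangle. Expressing the result through vertex values allows comparison
  between neighbouring triangles.\<close>

lemma rtri_integral:
  fixes A :: real and B P :: plane
  assumes "a \<noteq> 0" "b \<noteq> 0"
  shows "(LINT z:rtri P a b|lebesgue. A + B \<bullet> z) =
    \<bar>a * b\<bar> / 2 * (((A + B \<bullet> P) + (A + B \<bullet> (P + (a, 0))) + (A + B \<bullet> (P + (0, b)))) / 3)"
proof -
  let ?g = "\<lambda>z. indicator (rtri P a b) z *\<^sub>R (A + B \<bullet> z)"
  \<comment> \<open>Scaling by \<open>a\<close> and \<open>b\<close> along the two axes and
    translation by \<open>P\<close>, in the shape that \<open>lborel_affine_euclidean\<close>
    expects.\<close>
  define c where "c = (\<lambda>j::plane. if j = (1,0) then a else b)"
  let ?T = "\<lambda>x. P + (\<Sum>j\<in>Basis. (c j * (x \<bullet> j)) *\<^sub>R j)"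
  have T: "?T x = (fst P + a * fst x, snd P + b * snd x)" for x
    by (cases x, cases P) (simp add: Basis_prod_def c_def)
  have c0: "c j \<noteq> 0" for j using assms by (simp add: c_def)
  have pr: "(\<Prod>j\<in>Basis. \<bar>c j\<bar>) = \<bar>a * b\<bar>"
    by (simp add: Basis_prod_def c_def abs_mult)
  have gm: "?g \<in> borel_measurable borel"
    by (intro borel_measurable_scaleR borel_measurable_indicator borel_open open_rtri) measurable
  have Tm: "?T \<in> borel_measurable borel" by measurable
  have "(LINT z:rtri P a b|lebesgue. A + B \<bullet> z) = integral\<^sup>L lborel ?g"
    unfolding set_lebesgue_integral_def by (rule integral_completion) (use gm in simp)
  also have "\<dots> = integral\<^sup>L (density (distr lborel borel ?T) (\<lambda>_. ennreal (\<Prod>j\<in>Basis. \<bar>c j\<bar>))) ?g"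
    using arg_cong[OF lborel_affine_euclidean[of c P], of "\<lambda>M. integral\<^sup>L M ?g"] c0
    by (simp add: prod_ennreal)
  also have "\<dots> = (\<Prod>j\<in>Basis. \<bar>c j\<bar>) * (LINT x|lborel. ?g (?T x))"
    using gm Tm by (subst integral_density) (auto simp: integral_distr intro!: prod_nonneg)
  also have "(LINT x|lborel. ?g (?T x)) =
      (LINT z:rtri 0 1 1|lborel. (A + B \<bullet> P) + (fst B * a) * fst z + (snd B * b) * snd z)"
    unfolding set_lebesgue_integral_def T
    by (rule Bochner_Integration.integral_cong)
       (use assms in \<open>auto simp: indicator_def rtri_def inner_prod_def algebra_simps\<close>)
  also have "\<dots> = (A + B \<bullet> P) / 2 + (fst B * a) / 6 + (snd B * b) / 6"
    by (rule standard_triangle_integral)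
  finally show ?thesis unfolding pr by (simp add: inner_prod_def algebra_simps)
qed

section \<open>Piecewise affine functions on the triangulation\<close>

lemma rtri_subset_hull:
  "rtri P a b \<subseteq> convex hull {P, P + (a, 0), P + (0, b)}"
proof
  fix z assume z: "z \<in> rtri P a b"
  define s t where "s = (fst z - fst P) / a" and "t = (snd z - snd P) / b"
  have st: "0 < s" "0 < t" "s + t < 1" using z by (auto simp: rtri_def s_def t_def)
  then have "a \<noteq> 0" "b \<noteq> 0" by (auto simp: s_def t_def)
  then have "z = (1 - s - t) *\<^sub>R P + s *\<^sub>R (P + (a, 0)) + t *\<^sub>R (P + (0, b))"
    by (intro prod_eqI) (simp_all add: s_def t_def field_simps)
  then show "z \<in> convex hull {P, P + (a, 0), P + (0, b)}"
    unfolding convex_hull_3 using st by (intro CollectI exI[of _ "1 - s - t"] exI[of _ s] exI[of _ t]) auto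
qed

text \<open>Openness of \<open>S\<close> keeps short segments through \<open>z\<close> inside
  \<open>S\<close>, so the difference quotients see only the affine formula.\<close>

lemma grad_affine:
  assumes "open S" "z \<in> S" "\<And>z. z \<in> S \<Longrightarrow> v z = A + B \<bullet> z"
  shows "grad v z = B"
proof -
  have "partial e v z = B \<bullet> e" for e
    unfolding partial_def
  proof (rule DERIV_imp_deriv)
    have "((\<lambda>s. A + B \<bullet> (z + s *\<^sub>R e)) has_field_derivative B \<bullet> e) (at 0)"
      by (auto simp: inner_add_right intro!: derivative_eq_intros)
    moreover have "open ((\<lambda>s. z + s *\<^sub>R e) -` S)"
      by (rule open_vimage) (use assms in \<open>auto intro!: continuous_intros\<close>)
    ultimately show "((\<lambda>s. v (z + s *\<^sub>R e)) has_field_derivative B \<bullet> e) (at 0)"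
      by (rule has_field_derivative_transform_within_open) (use assms in auto)
  qed
  then show ?thesis by (cases B) (simp add: grad_def)
qed

lemma norm_rot90: "norm (rot90 g) = norm g"
  by (simp add: rot90_def norm_prod_def add.commute)

locale mesh =
  fixes L :: real and n :: nat and x y :: "nat \<Rightarrow> real" and d :: "nat \<Rightarrow> nat \<Rightarrow> bool"
  assumes L_pos: "0 < L" and grid_x: "grid_points L n x" and grid_y: "grid_points L n y"
begin

abbreviation "\<T> \<equiv> grid_triangulation n x y d"

text \<open>The triangle \<open>(i, j, s)\<close> lies in the cell \<open>(i, j)\<close>; its right angle is at the node
  \<open>(rp, rq)\<close>, and its other two vertices are \<open>(cp, rq)\<close> and \<open>(rp, cq)\<close>. The legs \<open>la\<close>, \<open>lb\<close> are signed.\<close>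

fun rp cp rq cq :: "nat \<times> nat \<times> bool \<Rightarrow> nat" where
  "rp (i, j, s) = i + of_bool s"
| "cp (i, j, s) = i + of_bool (\<not> s)"
| "rq (i, j, s) = j + of_bool (s \<noteq> d i j)"
| "cq (i, j, s) = j + of_bool (s = d i j)"

definition TI :: "(nat \<times> nat \<times> bool) set" where
  "TI = {..<n - 1} \<times> {..<n - 1} \<times> UNIV"

definition corner :: "nat \<times> nat \<times> bool \<Rightarrow> plane" where "corner t = (x (rp t), y (rq t))"
definition la :: "nat \<times> nat \<times> bool \<Rightarrow> real" where "la t = x (cp t) - x (rp t)"
definition lb :: "nat \<times> nat \<times> bool \<Rightarrow> real" where "lb t = y (cq t) - y (rq t)"
definition tri :: "nat \<times> nat \<times> bool \<Rightarrow> plane set" where "tri t = rtri (corner t) (la t) (lb t)"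

text \<open>The legs are parallel to the axes, so the divided differences along them are the
  components of the constant gradient on the triangle.\<close>

definition slope :: "(plane \<Rightarrow> real) \<Rightarrow> nat \<times> nat \<times> bool \<Rightarrow> plane" where
  "slope v t = ((v (x (cp t), y (rq t)) - v (x (rp t), y (rq t))) / la t,
                (v (x (rp t), y (cq t)) - v (x (rp t), y (rq t))) / lb t)"

section \<open>Order of the nodes and shape of the triangles\<close>

lemma n_ge2: "2 \<le> n"
  using grid_x by (simp add: grid_points_def)

lemma x_less: "i < j \<Longrightarrow> j < n \<Longrightarrow> x i < x j"
  using grid_x by (auto simp: grid_points_def strict_mono_on_def)

lemma y_less: "i < j \<Longrightarrow> j < n \<Longrightarrow> y i < y j"
  using grid_y by (auto simp: grid_points_def strict_mono_on_def)

lemma x_le: "i \<le> j \<Longrightarrow> j < n \<Longrightarrow> x i \<le> x j"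
  using x_less by (cases "i = j") (auto simp: less_imp_le)

lemma y_le: "i \<le> j \<Longrightarrow> j < n \<Longrightarrow> y i \<le> y j"
  using y_less by (cases "i = j") (auto simp: less_imp_le)

lemma x_ends: "x 0 = 0" "x (n - 1) = L"
  using grid_x by (auto simp: grid_points_def)

lemma y_ends: "y 0 = 0" "y (n - 1) = L"
  using grid_y by (auto simp: grid_points_def)

lemma x_range: "i < n \<Longrightarrow> x i \<in> {0..L}"
  using x_le[of 0 i] x_le[of i "n - 1"] x_ends by auto

lemma y_range: "i < n \<Longrightarrow> y i \<in> {0..L}"
  using y_le[of 0 i] y_le[of i "n - 1"] y_ends by auto

lemma finite_TI [simp]: "finite TI"
  by (simp add: TI_def)

lemma sum_TI: "(\<Sum>t\<in>TI. F t) = (\<Sum>i<n - 1. \<Sum>j<n - 1. F (i, j, True) + F (i, j, False))"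
  unfolding TI_def by (simp add: sum.cartesian_product' UNIV_bool add.commute)

lemma node_bounds:
  assumes "t \<in> TI"
  shows "rp t < n" "cp t < n" "rq t < n" "cq t < n"
  using assms by (auto simp: TI_def split: if_splits)

lemma legs_nonzero: 
  assumes "t \<in> TI"
  shows "la t \<noteq> 0" "lb t \<noteq> 0"
proof -
  obtain i j s where t: "t = (i, j, s)" "i < n - 1" "j < n - 1" using assms by (auto simp: TI_def)
  have "x i < x (Suc i)" "y j < y (Suc j)" using t by (auto intro: x_less y_less)
  then show "la t \<noteq> 0" "lb t \<noteq> 0" by (auto simp: t la_def lb_def)
qed

lemma hull_in_triangulation:
  assumes "t \<in> TI"
  shows "convex hull {corner t, corner t + (la t, 0), corner t + (0, lb t)} \<in> \<T>"
proof -
  obtain i j s where t: "t = (i, j, s)" "i < n - 1" "j < n - 1" using assms by (auto simp: TI_def)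
  have "convex hull {corner t, corner t + (la t, 0), corner t + (0, lb t)} \<in> cell_triangles x y d i j"
    by (cases s; cases "d i j")
       (auto simp: t corner_def la_def lb_def cell_triangles_def Let_def insert_commute)
  then show ?thesis using t unfolding grid_triangulation_def by blast
qed

text \<open>The differences along the two legs determine the linear part. The vertices are adjoined
  because the open set \<open>tri t\<close> does not contain them.\<close>

lemma X_N_affine:
  assumes v: "v \<in> X_N L \<T>" and t: "t \<in> TI"
  shows "\<exists>A. \<forall>z \<in> tri t \<union> {corner t, corner t + (la t, 0), corner t + (0, lb t)}. v z = A + slope v t \<bullet> z"
proof -
  let ?H = "convex hull {corner t, corner t + (la t, 0), corner t + (0, lb t)}"
  obtain A B where AB: "\<forall>z\<in>?H. v z = A + B \<bullet> z"
    using v hull_in_triangulation[OF t] unfolding X_N_def by blast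
  have sub: "tri t \<union> {corner t, corner t + (la t, 0), corner t + (0, lb t)} \<subseteq> ?H"
    using rtri_subset_hull[of "corner t" "la t" "lb t"] hull_subset[of "{corner t, corner t + (la t, 0), corner t + (0, lb t)}" convex]
    by (auto simp: tri_def)
  then have vert: "v (corner t) = A + B \<bullet> corner t" "v (corner t + (la t, 0)) = A + B \<bullet> (corner t + (la t, 0))"
     "v (corner t + (0, lb t)) = A + B \<bullet> (corner t + (0, lb t))"
    using AB by auto
  have "slope v t = B"
  proof (rule prod_eqI)
    have "v (corner t + (la t, 0)) - v (corner t) = fst B * la t" using vert by (cases B) (simp add: inner_add_right)
    then show "fst (slope v t) = fst B"
      using legs_nonzero[OF t] by (simp add: slope_def corner_def la_def field_simps)
    have "v (corner t + (0, lb t)) - v (corner t) = snd B * lb t" using vert by (cases B) (simp add: inner_add_right)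
    then show "snd (slope v t) = snd B"
      using legs_nonzero[OF t] by (simp add: slope_def corner_def lb_def field_simps)
  qed
  then show ?thesis using AB sub by blast
qed

lemma open_tri: "open (tri t)"
  by (simp add: tri_def open_rtri)

lemma grad_on_tri:
  assumes "v \<in> X_N L \<T>" "t \<in> TI" "z \<in> tri t"
  shows "grad v z = slope v t"
  using X_N_affine[OF assms(1,2)] grad_affine[OF open_tri assms(3)] by blast

text \<open>Positions along the legs, in units of the signed leg lengths, are barycentric
  coordinates. This transfers bounds at the nodes to the whole triangle.\<close>

lemma X_N_barycentric:
  assumes v: "v \<in> X_N L \<T>" and t: "t \<in> TI" and z: "z \<in> tri t"
  shows "\<exists>r s. 0 < r \<and> 0 < s \<and> r + s < 1 \<and>
     v z = (1 - r - s) * v (x (rp t), y (rq t)) + r * v (x (cp t), y (rq t)) + s * v (x (rp t), y (cq t))"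
proof -
  define r s where "r = (fst z - fst (corner t)) / la t" and "s = (snd z - snd (corner t)) / lb t"
  have rs: "0 < r" "0 < s" "r + s < 1" using z by (auto simp: tri_def rtri_def r_def s_def)
  obtain A where A: "\<forall>z \<in> tri t \<union> {corner t, corner t + (la t, 0), corner t + (0, lb t)}. v z = A + slope v t \<bullet> z"
    using X_N_affine[OF v t] by blast
  have "v z - v (corner t) = slope v t \<bullet> (z - corner t)" using A z by (simp add: inner_diff_right)
  also have "\<dots> = r * (v (x (cp t), y (rq t)) - v (x (rp t), y (rq t))) + s * (v (x (rp t), y (cq t)) - v (x (rp t), y (rq t)))"
    by (simp add: slope_def inner_prod_def r_def s_def mult_ac)
  finally have "v z = (1 - r - s) * v (x (rp t), y (rq t)) + r * v (x (cp t), y (rq t)) + s * v (x (rp t), y (cq t))"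
    by (simp add: corner_def algebra_simps)
  with rs show ?thesis by blast
qed

text \<open>After rescaling the cell to the unit square, each triangle is one side of the chosen
  diagonal. Disjointness and covering then become inequalities between \<open>\<sigma>\<close> and
  \<open>\<omega>\<close>.\<close>

lemma mem_tri_iff:
  assumes "i < n - 1" "j < n - 1"
  defines "\<sigma> \<equiv> \<lambda>z :: plane. (fst z - x i) / (x (Suc i) - x i)"
    and "\<omega> \<equiv> \<lambda>z :: plane. (snd z - y j) / (y (Suc j) - y j)"
  shows "z \<in> tri (i, j, s) \<longleftrightarrow> 0 < \<sigma> z \<and> 0 < \<omega> z \<and> \<sigma> z < 1 \<and> \<omega> z < 1 \<and>
    (if d i j then (if s then \<omega> z < \<sigma> z else \<sigma> z < \<omega> z)
     else (if s then 1 < \<sigma> z + \<omega> z else \<sigma> z + \<omega> z < 1))"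
proof -
  have xy: "x i < x (Suc i)" "y j < y (Suc j)" using assms by (auto intro: x_less y_less)
  have x'': "(fst z - x i) / (x (Suc i) - x i) = \<sigma> z" and y'': "(snd z - y j) / (y (Suc j) - y j) = \<omega> z"
    by (simp_all add: \<sigma>_def \<omega>_def)
  have x': "(fst z - x (Suc i)) / (x i - x (Suc i)) = 1 - \<sigma> z" using xy by (simp add: \<sigma>_def field_simps)
  have y': "(snd z - y (Suc j)) / (y j - y (Suc j)) = 1 - \<omega> z" using xy by (simp add: \<omega>_def field_simps)
  show ?thesis
    unfolding tri_def rtri_def corner_def la_def lb_def
    by (cases s; cases "d i j") (auto simp: x' y' x'' y'')
qed

lemma tri_in_cell:
  assumes "i < n - 1" "j < n - 1" "z \<in> tri (i, j, s)"
  shows "x i < fst z" "fst z < x (Suc i)" "y j < snd z" "snd z < y (Suc j)"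
proof -
  have xy: "x i < x (Suc i)" "y j < y (Suc j)" using assms by (auto intro: x_less y_less)
  show "x i < fst z" "fst z < x (Suc i)" "y j < snd z" "snd z < y (Suc j)"
    using assms(3) xy unfolding mem_tri_iff[OF assms(1,2)] by (auto simp: zero_less_divide_iff divide_less_eq)
qed

lemma strip_unique_x:
  assumes "i < n - 1" "i' < n - 1" "x i < r" "r < x (Suc i)" "x i' < r" "r < x (Suc i')"
  shows "i = i'"
proof (rule ccontr)
  assume "i \<noteq> i'"
  then consider "Suc i \<le> i'" | "Suc i' \<le> i" by linarith
  then show False
  proof cases
    case 1
    moreover have "i' < n" using assms by linarith
    ultimately show ?thesis using x_le[of "Suc i" i'] assms by linarith
  next
    case 2
    moreover have "i < n" using assms by linarith
    ultimately show ?thesis using x_le[of "Suc i'" i] assms by linarith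
  qed
qed

lemma strip_unique_y:
  assumes "i < n - 1" "i' < n - 1" "y i < r" "r < y (Suc i)" "y i' < r" "r < y (Suc i')"
  shows "i = i'"
proof (rule ccontr)
  assume "i \<noteq> i'"
  then consider "Suc i \<le> i'" | "Suc i' \<le> i" by linarith
  then show False
  proof cases
    case 1
    moreover have "i' < n" using assms by linarith
    ultimately show ?thesis using y_le[of "Suc i" i'] assms by linarith
  next
    case 2
    moreover have "i < n" using assms by linarith
    ultimately show ?thesis using y_le[of "Suc i'" i] assms by linarith
  qed
qed

text \<open>Different cells are separated by their coordinate strips, the two triangles of one cell
  by the strict sides of its diagonal.\<close>

lemma disjoint_tri: "disjoint_family_on tri TI"
  unfolding disjoint_family_on_def
proof (intro ballI impI)
  fix t t' assume t: "t \<in> TI" "t' \<in> TI" "t \<noteq> t'"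
  obtain i j s where ts: "t = (i, j, s)" "i < n - 1" "j < n - 1" using t by (auto simp: TI_def)
  obtain i' j' s' where ts': "t' = (i', j', s')" "i' < n - 1" "j' < n - 1" using t by (auto simp: TI_def)
  show "tri t \<inter> tri t' = {}"
  proof (rule ccontr)
    assume "tri t \<inter> tri t' \<noteq> {}"
    then obtain z where z: "z \<in> tri (i, j, s)" "z \<in> tri (i', j', s')" using ts ts' by auto
    have "i = i'" "j = j'"
      using strip_unique_x[OF ts(2) ts'(2)] strip_unique_y[OF ts(3) ts'(3)]
        tri_in_cell[OF ts(2,3) z(1)] tri_in_cell[OF ts'(2,3) z(2)] by blast+
    moreover have "s \<noteq> s'" using t(3) ts ts' \<open>i = i'\<close> \<open>j = j'\<close> by auto
    ultimately show False
      using z unfolding \<open>i = i'\<close> \<open>j = j'\<close> mem_tri_iff[OF ts'(2,3)] by (cases s; cases s') (auto split: if_splits)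
  qed
qed

lemma tri_subset_Omega: "t \<in> TI \<Longrightarrow> tri t \<subseteq> Omega L"
proof
  fix z assume t: "t \<in> TI" and z: "z \<in> tri t"
  obtain i j s where ts: "t = (i, j, s)" "i < n - 1" "j < n - 1" using t by (auto simp: TI_def)
  show "z \<in> Omega L"
    using tri_in_cell[OF ts(2,3)] z x_range[of i] x_range[of "Suc i"] y_range[of j] y_range[of "Suc j"] ts
    by (cases z) (fastforce simp: Omega_def)
qed

lemma locate:
  fixes f :: "nat \<Rightarrow> real"
  assumes "f 0 < r" "r < f m" "\<And>i. i \<le> m \<Longrightarrow> f i \<noteq> r"
  shows "\<exists>i<m. f i < r \<and> r < f (Suc i)"
  using assms
proof (induction m)
  case (Suc m)
  show ?case
  proof (cases "r < f m")
    case True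
    then obtain i where "i < m" "f i < r \<and> r < f (Suc i)"
      using Suc.IH[OF Suc.prems(1)] Suc.prems(3) by (meson le_Suc_eq)
    then show ?thesis by (meson less_SucI)
  next
    case False
    then have "f m < r" using Suc.prems(3)[of m] by simp
    then show ?thesis using Suc.prems by auto
  qed
qed simp

text \<open>The points missed by the open triangles lie on finitely many lines: the grid lines and,
  to be uniform in \<open>d\<close>, both diagonals of every cell.\<close>

lemma negligible_skeleton: "negligible (Omega L - \<Union>(tri ` TI))"
proof -
  let ?V = "\<Union>i<n. {z :: plane. (1, 0) \<bullet> z = x i}"
  let ?H = "\<Union>i<n. {z :: plane. (0, 1) \<bullet> z = y i}"
  let ?D = "\<lambda>i j. {z :: plane. (1 / (x (Suc i) - x i), - 1 / (y (Suc j) - y j)) \<bullet> z =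
                     x i / (x (Suc i) - x i) - y j / (y (Suc j) - y j)}"
  let ?E = "\<lambda>i j. {z :: plane. (1 / (x (Suc i) - x i), 1 / (y (Suc j) - y j)) \<bullet> z =
                     1 + x i / (x (Suc i) - x i) + y j / (y (Suc j) - y j)}"
  \<comment> \<open>This makes the normal vectors of the diagonals nonzero, so that the diagonals
    are hyperplanes.\<close>
  have "x (Suc i) \<noteq> x i" if "i < n - 1" for i
  proof -
    have "Suc i < n" using that by linarith
    then show ?thesis using x_less[of i "Suc i"] by simp
  qed
  then have "negligible (?V \<union> ?H \<union> (\<Union>i<n-1. \<Union>j<n-1. ?D i j \<union> ?E i j))"
    by (intro negligible_Un negligible_Union finite_imageI) (auto intro!: negligible_hyperplane negligible_Un negligible_Union simp: zero_prod_def)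
  moreover have "Omega L - \<Union>(tri ` TI) \<subseteq> ?V \<union> ?H \<union> (\<Union>i<n-1. \<Union>j<n-1. ?D i j \<union> ?E i j)"
  proof
    fix z assume z: "z \<in> Omega L - \<Union>(tri ` TI)"
    show "z \<in> ?V \<union> ?H \<union> (\<Union>i<n-1. \<Union>j<n-1. ?D i j \<union> ?E i j)"
    proof (cases "z \<in> ?V \<union> ?H")
      case False
      then have off: "x i \<noteq> fst z" "y i \<noteq> snd z" if "i < n" for i
        using that by (auto simp: inner_prod_def dest!: bspec[where x=i])
      have zO: "0 < fst z" "fst z < L" "0 < snd z" "snd z < L" using z by (auto simp: Omega_def)
      obtain i where i: "i < n - 1" "x i < fst z" "fst z < x (Suc i)"
        using locate[of x "fst z" "n - 1"] off(1) n_ge2 zO x_ends by auto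
      obtain j where j: "j < n - 1" "y j < snd z" "snd z < y (Suc j)"
        using locate[of y "snd z" "n - 1"] off(2) n_ge2 zO y_ends by auto
      define a b where "a = (fst z - x i) / (x (Suc i) - x i)" and "b = (snd z - y j) / (y (Suc j) - y j)"
      have ab: "0 < a" "a < 1" "0 < b" "b < 1" using i j by (auto simp: a_def b_def)
      have "z \<notin> tri (i, j, s)" for s using z i j by (auto simp: TI_def)
      from this[of True] this[of False] have "a = b \<or> a + b = 1"
        unfolding mem_tri_iff[OF i(1) j(1)] a_def[symmetric] b_def[symmetric] using ab by (auto split: if_splits)
      then have "z \<in> ?D i j \<union> ?E i j"
        by (auto simp: a_def b_def inner_prod_def diff_divide_distrib)
      then show ?thesis using i j by blast
    qed blast
  qed
  ultimately show ?thesis by (rule negligible_subset)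
qed

text \<open>The witness is continuous on the whole plane and hence bounded on each triangle;
  continuity on the open triangle alone would not give integrability. Values on the edges are left
  free.\<close>

definition pw :: "(plane \<Rightarrow> real) \<Rightarrow> bool" where
  "pw f \<longleftrightarrow> (\<forall>t\<in>TI. \<exists>g. continuous_on UNIV g \<and> (\<forall>z\<in>tri t. f z = g z))"

lemma pw_const : "pw (\<lambda>z. c)"
  unfolding pw_def by (auto intro!: exI[of _ "\<lambda>z. c"])

lemma pw_mult : assumes "pw f" "pw g" shows "pw (\<lambda>z. f z * g z)"
  unfolding pw_def
proof
  fix t assume "t \<in> TI"
  then obtain f' g' where "continuous_on UNIV f'" "\<forall>z\<in>tri t. f z = f' z" "continuous_on UNIV g'" "\<forall>z\<in>tri t. g z = g' z"
    using assms unfolding pw_def by meson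
  then show "\<exists>h. continuous_on UNIV h \<and> (\<forall>z\<in>tri t. f z * g z = h z)"
    by (intro exI[of _ "\<lambda>z. f' z * g' z"]) (auto intro: continuous_intros)
qed

lemma pw_power : "pw f \<Longrightarrow> pw (\<lambda>z. f z ^ k)"
  by (induction k) (simp_all add: pw_const pw_mult)

lemma pw_X_N: assumes "v \<in> X_N L \<T>" shows "pw v"
  unfolding pw_def
proof
  fix t assume "t \<in> TI"
  then obtain A where "\<forall>z\<in>tri t. v z = A + slope v t \<bullet> z" using X_N_affine[OF assms] by blast
  then show "\<exists>g. continuous_on UNIV g \<and> (\<forall>z\<in>tri t. v z = g z)"
    by (intro exI[of _ "\<lambda>z. A + slope v t \<bullet> z"]) (auto intro!: continuous_intros)
qed

text \<open>\<open>F\<close> may be arbitrary: both gradients are constant on each triangle, so the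
  composition is constant there too.\<close>

lemma pw_grad2:
  assumes "u \<in> X_N L \<T>" "v \<in> X_N L \<T>"
  shows "pw (\<lambda>z. F (grad u z) (grad v z))"
  unfolding pw_def
proof
  fix t assume "t \<in> TI"
  then show "\<exists>g. continuous_on UNIV g \<and> (\<forall>z\<in>tri t. F (grad u z) (grad v z) = g z)"
    by (intro exI[of _ "\<lambda>z. F (slope u t) (slope v t)"]) (simp add: grad_on_tri assms)
qed

lemma pw_grad: "u \<in> X_N L \<T> \<Longrightarrow> pw (\<lambda>z. F (grad u z))"
  using pw_grad2[of u u "\<lambda>a b. F a"] by simp

lemma open_Omega: "open (Omega L)"
  unfolding Omega_def by (intro open_Times) auto

lemma Omega_measurable [simp]: "Omega L \<in> sets lebesgue"
  using open_Omega by simp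

lemma AE_tri: "AE z in lebesgue_on (Omega L). \<exists>t\<in>TI. z \<in> tri t"
proof -
  have "Omega L - \<Union>(tri ` TI) \<in> null_sets lebesgue" using negligible_skeleton negligible_iff_null_sets by blast
  then have "AE z in lebesgue. z \<notin> Omega L - \<Union>(tri ` TI)" by (rule AE_not_in)
  then show ?thesis by (subst AE_restrict_space_iff) (auto elim!: eventually_mono)
qed

text \<open>The disjoint open triangles fill \<open>Omega L\<close> up to a null set, on which the
  values of \<open>f\<close> do not matter.\<close>

lemma pw_integral:
  assumes "pw f"
  shows "integrable (lebesgue_on (Omega L)) f"
    and "(LINT z|lebesgue_on (Omega L). f z) = (\<Sum>t\<in>TI. LINT z:tri t|lebesgue. f z)"
proof -
  have tri_int: "set_integrable lebesgue (tri t) f" if t: "t \<in> TI" for t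
  proof -
    obtain g where "continuous_on UNIV g" "\<forall>z\<in>tri t. f z = g z" using assms t unfolding pw_def by meson
    then show ?thesis unfolding tri_def by (intro set_integrable_rtri legs_nonzero t) auto
  qed
  have sub: "\<Union>(tri ` TI) \<subseteq> Omega L" using tri_subset_Omega by blast
  have "f absolutely_integrable_on (\<Union>(tri ` TI))"
    by (rule set_integrable_UN) (use tri_int open_tri in auto)
  moreover have neg: "negligible (Omega L - \<Union>(tri ` TI))" "negligible (\<Union>(tri ` TI) - Omega L)"
    using negligible_skeleton sub by (auto simp: Diff_eq_empty_iff[THEN iffD2])
  have spike: "negligible {z \<in> \<Union>(tri ` TI) - Omega L. f z \<noteq> 0}" "negligible {z \<in> Omega L - \<Union>(tri ` TI). f z \<noteq> 0}"
    using neg by (auto intro: negligible_subset)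
  ultimately have abs: "f absolutely_integrable_on (Omega L)"
    using absolutely_integrable_spike_set[OF _ spike] by blast
  then show "integrable (lebesgue_on (Omega L)) f"
    by (simp add: integrable_restrict_space set_integrable_def)
  have "(LINT z|lebesgue_on (Omega L). f z) = (LINT z:Omega L|lebesgue. f z)"
    by (simp add: integral_restrict_space set_lebesgue_integral_def)
  also have "\<dots> = integral (Omega L) f" using abs by (rule set_lebesgue_integral_eq_integral)
  also have "\<dots> = integral (\<Union>(tri ` TI)) f" by (rule integral_spike_set[OF spike(2,1)])
  also have "\<dots> = (LINT z:\<Union>(tri ` TI)|lebesgue. f z)"
    using \<open>f absolutely_integrable_on (\<Union>(tri ` TI))\<close> by (rule set_lebesgue_integral_eq_integral(2)[symmetric])
  also have "\<dots> = (\<Sum>t\<in>TI. LINT z:tri t|lebesgue. f z)"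
    by (rule set_integral_finite_Union) (use disjoint_tri tri_int open_tri in auto)
  finally show "(LINT z|lebesgue_on (Omega L). f z) = (\<Sum>t\<in>TI. LINT z:tri t|lebesgue. f z)" .
qed

lemma pw_measurable: "pw f \<Longrightarrow> f \<in> borel_measurable (lebesgue_on (Omega L))"
  using pw_integral(1) borel_measurable_integrable by blast

lemma tri_integral_const:
  assumes "t \<in> TI"
  shows "(LINT z:tri t|lebesgue. c) = \<bar>la t * lb t\<bar> / 2 * c"
  using rtri_integral[OF legs_nonzero[OF assms], where A=c and B=0 and P="corner t"] by (simp add: tri_def)

lemma tri_integral_X_N:
  assumes v: "v \<in> X_N L \<T>" and t: "t \<in> TI"
  shows "(LINT z:tri t|lebesgue. v z) = \<bar>la t * lb t\<bar> / 2 *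
    ((v (x (rp t), y (rq t)) + v (x (cp t), y (rq t)) + v (x (rp t), y (cq t))) / 3)"
proof -
  obtain A where A: "\<forall>z \<in> tri t \<union> {corner t, corner t + (la t, 0), corner t + (0, lb t)}. v z = A + slope v t \<bullet> z"
    using X_N_affine[OF v t] by blast
  have "(LINT z:tri t|lebesgue. v z) = (LINT z:tri t|lebesgue. A + slope v t \<bullet> z)"
    by (rule set_lebesgue_integral_cong) (use A open_tri in auto)
  also have "\<dots> = \<bar>la t * lb t\<bar> / 2 * ((v (corner t) + v (corner t + (la t, 0)) + v (corner t + (0, lb t))) / 3)"
    using rtri_integral[OF legs_nonzero[OF t], of "corner t" A "slope v t"] A by (simp add: tri_def)
  finally show ?thesis by (simp add: corner_def la_def lb_def)
qed

end

text \<open>The divergence theorem on one triangle for affine \<open>u\<close> and \<open>v\<close>,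
  in vertex values. On an edge with end values \<open>a\<close> and \<open>b\<close> of
  \<open>v\<close>, the mean of \<open>v\<^sup>2\<close> is
  \<open>(a\<^sup>2 + a * b + b\<^sup>2) / 3\<close>.\<close>

lemma triangle_edge_identity:
  fixes u1 u2 u3 v1 v2 v3 :: real
  shows "((u2 - u1) * (v3 - v1) - (u3 - u1) * (v2 - v1)) * (v1 + v2 + v3) =
    (u1 - u2) * (v1\<^sup>2 + v1 * v2 + v2\<^sup>2) + (u2 - u3) * (v2\<^sup>2 + v2 * v3 + v3\<^sup>2) + (u3 - u1) * (v3\<^sup>2 + v3 * v1 + v1\<^sup>2)"
  by (simp add: power2_eq_square algebra_simps)

lemma div_abs_sgn:
  fixes p :: real
  assumes "p \<noteq> 0"
  shows "a / p * (\<bar>p\<bar> / 2 * (b / 3)) = sgn p * (a * b / 6)"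
  using assms by (cases "0 < p") (auto simp: sgn_if)

lemma sum_shift_periodic:
  fixes f :: "nat \<Rightarrow> real"
  assumes "f m = f 0"
  shows "(\<Sum>i<m. f (Suc i)) = (\<Sum>i<m. f i)"
  using sum.lessThan_Suc_shift[of f m] sum.lessThan_Suc[of f m] assms by simp

lemma sum_shift_diff:
  fixes f :: "nat \<Rightarrow> real"
  shows "f m = f 0 \<Longrightarrow> (\<Sum>i<m. f (Suc i) - f i) = 0"
  using sum_shift_periodic[of f m] by (simp add: sum_subtractf)

section \<open>Periodic functions and skew symmetry of convection\<close>

context mesh
begin

lemma X_NP_X_N: "v \<in> X_NP L \<T> \<Longrightarrow> v \<in> X_N L \<T>"
  by (simp add: X_NP_def)

lemma X_NP_ends:
  assumes "v \<in> X_NP L \<T>" "i < n"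
  shows "v (x (n - 1), y i) = v (x 0, y i)" "v (x i, y (n - 1)) = v (x i, y 0)"
  using assms x_range[of i] y_range[of i] x_ends y_ends by (auto simp: X_NP_def)

text \<open>Only the index \<open>n - 1\<close> is wrapped, to \<open>0\<close>. Thus the
  \<open>(n - 1)\<^sup>2\<close> free nodes determine all nodal values.\<close>

lemma X_NP_node_mod:
  assumes v: "v \<in> X_NP L \<T>" and ij: "i < n" "j < n"
  shows "v (x i, y j) = v (x (i mod (n - 1)), y (j mod (n - 1)))"
proof -
  have m: "k mod (n - 1) = (if k = n - 1 then 0 else k)" if "k < n" for k
  proof (cases "k = n - 1")
    case False
    then have "k < n - 1" using that by linarith
    then show ?thesis by simp
  qed simp
  have "v (x i, y j) = v (x (i mod (n - 1)), y j)"
    unfolding m[OF ij(1)] using X_NP_ends(1)[OF v ij(2)] by (cases "i = n - 1") simp_all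
  also have "\<dots> = v (x (i mod (n - 1)), y (j mod (n - 1)))"
  proof -
    have "i mod (n - 1) < n" using mod_less_eq_dividend[of i "n - 1"] ij(1) by (rule le_less_trans)
    then show ?thesis
      unfolding m[OF ij(2)] using X_NP_ends(2)[OF v] by (cases "j = n - 1") simp_all
  qed
  finally show ?thesis .
qed

text \<open>On each triangle the integrand is, up to sign, a sum over the three edges; inner edges cancel,
  and the edges on opposite sides of the square cancel by periodicity.\<close>

lemma convection_skew:
  assumes u: "u \<in> X_NP L \<T>" and v: "v \<in> X_NP L \<T>"
  shows "(LINT z|lebesgue_on (Omega L). (rot90 (grad u z) \<bullet> grad v z) * v z) = 0"
proof -
  note uN = X_NP_X_N[OF u] and vN = X_NP_X_N[OF v]
  let ?F = "\<lambda>t. LINT z:tri t|lebesgue. (rot90 (grad u z) \<bullet> grad v z) * v z"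
  define U V where "U = (\<lambda>i j. u (x i, y j))" and "V = (\<lambda>i j. v (x i, y j))"
  \<comment> \<open>The contribution of one edge: the drop of \<open>u\<close> along it times half
    the mean of \<open>v\<^sup>2\<close>. \<open>H\<close> and \<open>Y\<close> below are those of
    the horizontal and vertical edges.\<close>
  define E where "E = (\<lambda>p q a b. (p - q) * (a\<^sup>2 + a * b + b\<^sup>2) / (6 :: real))"
  define H where "H = (\<lambda>i j. E (U i j) (U (Suc i) j) (V i j) (V (Suc i) j))"
  define Y where "Y = (\<lambda>i j. E (U i j) (U i (Suc j)) (V i j) (V i (Suc j)))"
  have F: "?F t = sgn (la t * lb t) * (E (U (rp t) (rq t)) (U (cp t) (rq t)) (V (rp t) (rq t)) (V (cp t) (rq t))
       + E (U (cp t) (rq t)) (U (rp t) (cq t)) (V (cp t) (rq t)) (V (rp t) (cq t))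
       + E (U (rp t) (cq t)) (U (rp t) (rq t)) (V (rp t) (cq t)) (V (rp t) (rq t)))" if t: "t \<in> TI" for t
  proof -
    have "?F t = (LINT z:tri t|lebesgue. (rot90 (slope u t) \<bullet> slope v t) * v z)"
      by (rule set_lebesgue_integral_cong) (use grad_on_tri[OF uN t] grad_on_tri[OF vN t] open_tri in auto)
    also have "\<dots> = (rot90 (slope u t) \<bullet> slope v t) * (\<bar>la t * lb t\<bar> / 2 *
        ((V (rp t) (rq t) + V (cp t) (rq t) + V (rp t) (cq t)) / 3))"
      by (simp add: tri_integral_X_N[OF vN t] V_def)
    also have "rot90 (slope u t) \<bullet> slope v t =
      ((U (cp t) (rq t) - U (rp t) (rq t)) * (V (rp t) (cq t) - V (rp t) (rq t))
        - (U (rp t) (cq t) - U (rp t) (rq t)) * (V (cp t) (rq t) - V (rp t) (rq t))) / (la t * lb t)"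
      using legs_nonzero[OF t] by (simp add: rot90_def slope_def U_def V_def field_simps)
    also have "\<dots> * (\<bar>la t * lb t\<bar> / 2 * ((V (rp t) (rq t) + V (cp t) (rq t) + V (rp t) (cq t)) / 3)) =
      sgn (la t * lb t) * ((((U (cp t) (rq t) - U (rp t) (rq t)) * (V (rp t) (cq t) - V (rp t) (rq t))
        - (U (rp t) (cq t) - U (rp t) (rq t)) * (V (cp t) (rq t) - V (rp t) (rq t)))
        * (V (rp t) (rq t) + V (cp t) (rq t) + V (rp t) (cq t))) / 6)"
      by (rule div_abs_sgn) (use legs_nonzero[OF t] in simp)
    finally show ?thesis
      unfolding triangle_edge_identity E_def by (simp add: add_divide_distrib)
  qed
  have E_anti: "E q p b a = - E p q a b" for p q a b
    by (simp add: E_def field_simps)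
  have cell: "?F (i, j, True) + ?F (i, j, False) = (Y (Suc i) j - Y i j) - (H i (Suc j) - H i j)"
    if ij: "i < n - 1" "j < n - 1" for i j
  proof -
    have xy: "x i < x (Suc i)" "y j < y (Suc j)" using ij by (auto intro: x_less y_less)
    have t: "(i, j, s) \<in> TI" for s using ij by (auto simp: TI_def)
    \<comment> \<open>Both triangles of a cell carry the same sign, so their common diagonal,
      traversed in opposite directions, cancels.\<close>
    have sg: "sgn (la (i, j, s) * lb (i, j, s)) = (if d i j then - 1 else 1)" for s
      using xy by (cases s) (auto simp: la_def lb_def sgn_mult)
    show ?thesis
      unfolding F[OF t] sg
      by (cases "d i j") (simp_all add: H_def Y_def, simp_all add: E_def field_simps)
  qed
  have pw: "pw (\<lambda>z. (rot90 (grad u z) \<bullet> grad v z) * v z)"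
    by (intro pw_mult pw_X_N[OF vN] pw_grad2[OF uN vN])
  have "(LINT z|lebesgue_on (Omega L). (rot90 (grad u z) \<bullet> grad v z) * v z) =
     (\<Sum>i<n - 1. \<Sum>j<n - 1. (Y (Suc i) j - Y i j) - (H i (Suc j) - H i j))"
    by (simp add: pw_integral(2)[OF pw] sum_TI cell)
  \<comment> \<open>Each difference is summed first over the index that it shifts, so that it
    telescopes.\<close>
  also have "\<dots> = (\<Sum>j<n - 1. \<Sum>i<n - 1. Y (Suc i) j - Y i j) - (\<Sum>i<n - 1. \<Sum>j<n - 1. H i (Suc j) - H i j)"
    by (subst (2) sum.swap) (simp add: sum_subtractf)
  also have "\<dots> = 0"
  proof -
    have "Y (n - 1) j = Y 0 j" if "j < n - 1" for j
      using X_NP_ends(1)[OF u, of j] X_NP_ends(1)[OF v, of j] X_NP_ends(1)[OF u, of "Suc j"] X_NP_ends(1)[OF v, of "Suc j"] that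
      by (simp add: Y_def U_def V_def)
    moreover have "H i (n - 1) = H i 0" if "i < n - 1" for i
      using X_NP_ends(2)[OF u, of i] X_NP_ends(2)[OF v, of i] X_NP_ends(2)[OF u, of "Suc i"] X_NP_ends(2)[OF v, of "Suc i"] that
      by (simp add: H_def U_def V_def)
    ultimately show ?thesis
      using sum_shift_diff[of "\<lambda>i. Y i j" "n - 1" for j] sum_shift_diff[of "H i" "n - 1" for i] by simp
  qed
  finally show ?thesis .
qed

text \<open>The points of \<open>Omega L\<close> where \<open>v\<close> does not vanish form an open
  null set, which is empty; continuity reaches the boundary. This makes the norm on coefficient
  vectors definite.\<close>

lemma X_N_zero:
  assumes v: "v \<in> X_N L \<T>" and z: "(LINT z|lebesgue_on (Omega L). (v z)\<^sup>2) = 0" and w: "w \<in> Omega_bar L"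
  shows "v w = 0"
proof -
  have cont: "continuous_on (Omega_bar L) v" using v by (simp add: X_N_def)
  have sub: "Omega L \<subseteq> Omega_bar L" by (auto simp: Omega_def Omega_bar_def)
  have op: "open {z \<in> Omega L. v z \<noteq> 0}"
  proof -
    have "open (Omega L \<inter> v -` (- {0}))"
      by (rule continuous_open_preimage) (use cont sub open_Omega continuous_on_subset in auto)
    moreover have "Omega L \<inter> v -` (- {0}) = {z \<in> Omega L. v z \<noteq> 0}" by auto
    ultimately show ?thesis by simp
  qed
  have "AE z in lebesgue_on (Omega L). (v z)\<^sup>2 = 0"
    using integral_nonneg_eq_0_iff_AE[OF pw_integral(1)[OF pw_power[OF pw_X_N[OF v], of 2]]] z by simp
  then have "AE z in lebesgue. z \<notin> {z \<in> Omega L. v z \<noteq> 0}"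
    by (simp add: AE_restrict_space_iff)
  moreover have "{z \<in> Omega L. v z \<noteq> 0} \<in> sets lebesgue" using op by simp
  ultimately have "{z \<in> Omega L. v z \<noteq> 0} \<in> null_sets lebesgue"
    by (simp only: AE_iff_null_sets)
  then have "negligible {z \<in> Omega L. v z \<noteq> 0}" by (simp add: negligible_iff_null_sets)
  then have "{z \<in> Omega L. v z \<noteq> 0} = {}" using op open_not_negligible by blast
  then have "v z = 0" if "z \<in> Omega L" for z using that by blast
  moreover have "closure (Omega L) = Omega_bar L"
    using L_pos by (simp add: Omega_def Omega_bar_def closure_Times)
  ultimately show ?thesis
    using continuous_constant_on_closure[of "Omega L" v 0 w] cont w by auto
qed

section \<open>Mesh size and the mass of a hat function\<close>

lemma mesh_size_ge:
  assumes t: "t \<in> TI"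
  shows "(la t)\<^sup>2 + (lb t)\<^sup>2 \<le> (mesh_size \<T>)\<^sup>2"
proof -
  let ?H = "convex hull {corner t, corner t + (la t, 0), corner t + (0, lb t)}"
  have fin: "finite \<T>" unfolding grid_triangulation_def cell_triangles_def by (auto simp: Let_def)
  \<comment> \<open>The two points are the ends of the hypotenuse.\<close>
  have "dist (corner t + (la t, 0)) (corner t + (0, lb t)) \<le> diameter ?H"
    by (intro diameter_bounded_bound bounded_convex_hull[OF finite_imp_bounded] hull_inc) simp_all
  also have "\<dots> \<le> mesh_size \<T>"
    unfolding mesh_size_def using fin hull_in_triangulation[OF t] by (intro Max_ge) auto
  finally have "sqrt ((la t)\<^sup>2 + (lb t)\<^sup>2) \<le> mesh_size \<T>"
    by (simp add: dist_norm norm_prod_def corner_def)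
  then show ?thesis by (metis sqrt_le_D)
qed

lemma mesh_size_pos: "0 < mesh_size \<T>"
proof -
  have t: "(0, 0, True) \<in> TI" using n_ge2 by (auto simp: TI_def)
  have fin: "finite \<T>" unfolding grid_triangulation_def cell_triangles_def by (auto simp: Let_def)
  have "0 \<le> diameter (convex hull {corner (0,0,True), corner (0,0,True) + (la (0,0,True), 0), corner (0,0,True) + (0, lb (0,0,True))})"
    by (intro diameter_ge_0 bounded_convex_hull finite_imp_bounded) simp
  also have "\<dots> \<le> mesh_size \<T>"
    unfolding mesh_size_def using fin hull_in_triangulation[OF t] by (intro Max_ge) auto
  finally have "0 \<le> mesh_size \<T>" .
  moreover have "(mesh_size \<T>)\<^sup>2 \<noteq> 0" using mesh_size_ge[OF t] legs_nonzero[OF t]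
    by (smt (verit) zero_less_power2 zero_le_power2)
  ultimately show ?thesis by (simp add: less_le)
qed

lemma pw_integral_mono:
  assumes "pw f" "pw g" "\<And>t z. t \<in> TI \<Longrightarrow> z \<in> tri t \<Longrightarrow> f z \<le> g z"
  shows "(LINT z|lebesgue_on (Omega L). f z) \<le> (LINT z|lebesgue_on (Omega L). g z)"
  by (rule integral_mono_AE[OF pw_integral(1)[OF assms(1)] pw_integral(1)[OF assms(2)]])
     (use AE_tri assms(3) in \<open>auto elim!: eventually_mono\<close>)

lemma integral_grad:
  assumes v: "v \<in> X_N L \<T>"
  shows "(LINT z|lebesgue_on (Omega L). F (grad v z)) = (\<Sum>t\<in>TI. \<bar>la t * lb t\<bar> / 2 * F (slope v t))"
proof -
  have "(LINT z:tri t|lebesgue. F (grad v z)) = \<bar>la t * lb t\<bar> / 2 * F (slope v t)" if t: "t \<in> TI" for t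
  proof -
    have "(LINT z:tri t|lebesgue. F (grad v z)) = (LINT z:tri t|lebesgue. F (slope v t))"
      by (rule set_lebesgue_integral_cong) (use grad_on_tri[OF v t] open_tri in auto)
    then show ?thesis by (simp only: tri_integral_const[OF t])
  qed
  then show ?thesis unfolding pw_integral(2)[OF pw_grad[OF v]] by (rule sum.cong[OF refl])
qed

text \<open>Since \<open>v\<close> takes values between 0 and 1, its mass is at most its integral,
  which depends only on the vertex values and the areas.\<close>

lemma hat_mass:
  assumes v: "v \<in> X_NP L \<T>" and h1: "mesh_size \<T> < 1"
    and nodes: "\<And>i j. i < n - 1 \<Longrightarrow> j < n - 1 \<Longrightarrow> v (x i, y j) = (if (i, j) = c then 1 else 0)"
    and c: "c \<in> {..<n - 1} \<times> {..<n - 1}"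
  shows "(LINT z|lebesgue_on (Omega L). (v z)\<^sup>2) \<le> 2 / 3"
proof -
  note vN = X_NP_X_N[OF v]
  define V where "V = (\<lambda>i j. v (x i, y j))"
  have V01: "0 \<le> V i j" "V i j \<le> 1" if "i < n" "j < n" for i j
  proof -
    have "i mod (n - 1) < n - 1" "j mod (n - 1) < n - 1" using n_ge2 by simp_all
    then have "V i j = (if (i mod (n - 1), j mod (n - 1)) = c then 1 else 0)"
      unfolding V_def X_NP_node_mod[OF v that] by (rule nodes)
    then show "0 \<le> V i j" "V i j \<le> 1" by (simp_all split: if_splits)
  qed
  have bound: "0 \<le> v z \<and> v z \<le> 1" if t: "t \<in> TI" and z: "z \<in> tri t" for t z
  proof -
    obtain r s where rs: "0 < r" "0 < s" "r + s < 1"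
      "v z = (1 - r - s) * V (rp t) (rq t) + r * V (cp t) (rq t) + s * V (rp t) (cq t)"
      using X_N_barycentric[OF vN t z] unfolding V_def by blast
    note nb = node_bounds[OF t]
    have "(1 - r - s) * V (rp t) (rq t) + r * V (cp t) (rq t) + s * V (rp t) (cq t) \<le> (1 - r - s) * 1 + r * 1 + s * 1"
      by (intro add_mono mult_left_mono V01 nb) (use rs in auto)
    moreover have "0 \<le> (1 - r - s) * V (rp t) (rq t) + r * V (cp t) (rq t) + s * V (rp t) (cq t)"
      by (intro add_nonneg_nonneg mult_nonneg_nonneg V01 nb) (use rs in auto)
    ultimately show ?thesis using rs by simp
  qed
  \<comment> \<open>The squared legs sum to at most 1, so a triangle has area at most
    \<open>1 / 4\<close>, and each of its vertices has weight at most \<open>1 / 12\<close> in the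
    integral.\<close>
  have area: "\<bar>la t * lb t\<bar> \<le> 1 / 2" if t: "t \<in> TI" for t
  proof -
    have "(la t)\<^sup>2 + (lb t)\<^sup>2 \<le> (mesh_size \<T>)\<^sup>2" by (rule mesh_size_ge[OF t])
    also have "\<dots> \<le> 1" using h1 mesh_size_pos by (simp add: power_le_one)
    finally show ?thesis using sum_squares_bound[of "\<bar>la t\<bar>" "\<bar>lb t\<bar>"] by (simp add: abs_mult)
  qed
  have tri_le: "(LINT z:tri t|lebesgue. v z) \<le> 1 / 12 * (V (rp t) (rq t) + V (cp t) (rq t) + V (rp t) (cq t))"
    if t: "t \<in> TI" for t
  proof -
    have "0 \<le> V (rp t) (rq t) + V (cp t) (rq t) + V (rp t) (cq t)" by (intro add_nonneg_nonneg V01 node_bounds[OF t])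
    then have "\<bar>la t * lb t\<bar> / 6 * (V (rp t) (rq t) + V (cp t) (rq t) + V (rp t) (cq t))
      \<le> 1 / 12 * (V (rp t) (rq t) + V (cp t) (rq t) + V (rp t) (cq t))"
      using area[OF t] by (intro mult_right_mono) auto
    then show ?thesis unfolding tri_integral_X_N[OF vN t] V_def by simp
  qed
  let ?C = "\<lambda>i j. V i j + V (Suc i) j + V i (Suc j) + V (Suc i) (Suc j)"
  \<comment> \<open>A corner of the cell is a vertex of at most two triangles of that cell, each
    giving it the weight \<open>1 / 12\<close>.\<close>
  have cell: "(LINT z:tri (i,j,True)|lebesgue. v z) + (LINT z:tri (i,j,False)|lebesgue. v z) \<le> 1 / 6 * ?C i j"
    if ij: "i < n - 1" "j < n - 1" for i j
  proof -
    have t: "(i, j, s) \<in> TI" for s using ij by (auto simp: TI_def)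
    have "0 \<le> V i j" "0 \<le> V (Suc i) j" "0 \<le> V i (Suc j)" "0 \<le> V (Suc i) (Suc j)" using ij by (auto intro: V01)
    then show ?thesis using tri_le[OF t, of True] tri_le[OF t, of False] by (cases "d i j") simp_all
  qed
  have one: "(\<Sum>i<n - 1. \<Sum>j<n - 1. V i j) = 1"
  proof -
    have "(\<Sum>i<n - 1. \<Sum>j<n - 1. V i j) = (\<Sum>p\<in>{..<n - 1} \<times> {..<n - 1}. if p = c then 1 else 0)"
      unfolding sum.cartesian_product' by (intro sum.cong refl) (auto simp: V_def nodes)
    also have "\<dots> = 1" using c by (simp add: sum.delta)
    finally show ?thesis .
  qed
  \<comment> \<open>By periodicity an index shift does not change a sum over the free nodes. All
    four corner sums are therefore equal to 1, and the total is \<open>4 / 6\<close>.\<close>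
  have shi: "(\<Sum>i<n - 1. V (Suc i) j) = (\<Sum>i<n - 1. V i j)" if "j < n" for j
    by (rule sum_shift_periodic) (use X_NP_ends(1)[OF v that] in \<open>simp add: V_def\<close>)
  have shj: "(\<Sum>j<n - 1. V i (Suc j)) = (\<Sum>j<n - 1. V i j)" if "i < n" for i
    by (rule sum_shift_periodic) (use X_NP_ends(2)[OF v that] in \<open>simp add: V_def\<close>)
  have s1: "(\<Sum>i<n - 1. \<Sum>j<n - 1. V (Suc i) j) = 1"
  proof -
    have "(\<Sum>i<n - 1. \<Sum>j<n - 1. V (Suc i) j) = (\<Sum>j<n - 1. \<Sum>i<n - 1. V (Suc i) j)" by (rule sum.swap)
    also have "\<dots> = (\<Sum>j<n - 1. \<Sum>i<n - 1. V i j)" by (intro sum.cong refl shi) auto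
    also have "\<dots> = (\<Sum>i<n - 1. \<Sum>j<n - 1. V i j)" by (rule sum.swap)
    finally show ?thesis using one by simp
  qed
  have s2: "(\<Sum>i<n - 1. \<Sum>j<n - 1. V i (Suc j)) = 1"
  proof -
    have "(\<Sum>i<n - 1. \<Sum>j<n - 1. V i (Suc j)) = (\<Sum>i<n - 1. \<Sum>j<n - 1. V i j)"
      by (intro sum.cong refl shj) auto
    then show ?thesis using one by simp
  qed
  have s3: "(\<Sum>i<n - 1. \<Sum>j<n - 1. V (Suc i) (Suc j)) = 1"
  proof -
    have "(\<Sum>i<n - 1. \<Sum>j<n - 1. V (Suc i) (Suc j)) = (\<Sum>i<n - 1. \<Sum>j<n - 1. V (Suc i) j)"
      by (intro sum.cong refl shj) auto
    then show ?thesis using s1 by simp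
  qed
  have "(LINT z|lebesgue_on (Omega L). (v z)\<^sup>2) \<le> (LINT z|lebesgue_on (Omega L). v z)"
  proof (rule pw_integral_mono)
    show "(v z)\<^sup>2 \<le> v z" if "t \<in> TI" "z \<in> tri t" for t z
      using bound[OF that] by (simp add: power2_eq_square mult_left_le)
  qed (intro pw_power pw_X_N[OF vN])+
  also have "\<dots> = (\<Sum>i<n - 1. \<Sum>j<n - 1. (LINT z:tri (i,j,True)|lebesgue. v z) + (LINT z:tri (i,j,False)|lebesgue. v z))"
    by (simp add: pw_integral(2)[OF pw_X_N[OF vN]] sum_TI)
  also have "\<dots> \<le> (\<Sum>i<n - 1. \<Sum>j<n - 1. 1 / 6 * ?C i j)"
    by (intro sum_mono cell) auto
  also have "\<dots> = 1 / 6 * (\<Sum>i<n - 1. \<Sum>j<n - 1. ?C i j)" by (simp add: sum_distrib_left)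
  also have "(\<Sum>i<n - 1. \<Sum>j<n - 1. ?C i j) = 4" unfolding sum.distrib one s1 s2 s3 by simp
  finally show ?thesis by simp
qed

text \<open>A nodal hat function \<open>\<psi>\<close> at the right-angled vertex of a triangle has \<open>L\<^sup>4\<close> gradient norm at least
  \<open>area powr (- 1/4)\<close>, while \<open>\<parallel>\<psi>\<parallel>\<^sup>2\<close> is at most \<open>2/3\<close> because cells have area below \<open>1/2\<close>.
  Hence the inverse inequality forces a lower bound for the area.\<close>

lemma gradient_L4_bound:
  assumes e: "e \<in> X_NP L \<T>" and h1: "mesh_size \<T> < 1"
    and hat: "\<And>c. c \<in> {..<n - 1} \<times> {..<n - 1} \<Longrightarrow>
      \<exists>v\<in>X_NP L \<T>. \<forall>i<n - 1. \<forall>j<n - 1. v (x i, y j) = (if (i, j) = c then 1 else 0)"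
    and inv: "\<And>v. v \<in> X_N L \<T> \<Longrightarrow>
      (LINT z|lebesgue_on (Omega L). norm (grad v z) ^ 4) \<le> C * (LINT z|lebesgue_on (Omega L). (v z)\<^sup>2)\<^sup>2"
    and C: "0 \<le> C"
  shows "(LINT z|lebesgue_on (Omega L). norm (grad e z) ^ 4) \<le>
     4 / 9 * C * (LINT z|lebesgue_on (Omega L). (norm (grad e z))\<^sup>2)\<^sup>2"
proof -
  note eN = X_NP_X_N[OF e]
  let ?G = "\<lambda>t. norm (slope e t)"
  have TI_ne: "TI \<noteq> {}" using n_ge2 by (auto simp: TI_def lessThan_empty_iff)
  \<comment> \<open>On the triangle \<open>t\<close> the gradient is largest. Pulling its square out
    of the fourth power reduces the claim to a bound of that maximum by \<open>S\<close>.\<close>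
  have "Max (?G ` TI) \<in> ?G ` TI" using TI_ne by (intro Max_in) auto
  then obtain t where t: "t \<in> TI" "Max (?G ` TI) = ?G t" by blast
  have mx: "?G s \<le> ?G t" if "s \<in> TI" for s using Max_ge[of "?G ` TI" "?G s"] that t by simp
  define S where "S = (LINT z|lebesgue_on (Omega L). (norm (grad e z))\<^sup>2)"
  have Q_le: "(LINT z|lebesgue_on (Omega L). norm (grad e z) ^ 4) \<le> (?G t)\<^sup>2 * S"
  proof -
    have "(LINT z|lebesgue_on (Omega L). norm (grad e z) ^ 4) \<le> (LINT z|lebesgue_on (Omega L). (?G t)\<^sup>2 * (norm (grad e z))\<^sup>2)"
    proof (rule pw_integral_mono)
      show "norm (grad e z) ^ 4 \<le> (?G t)\<^sup>2 * (norm (grad e z))\<^sup>2" if "s \<in> TI" "z \<in> tri s" for s z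
      proof -
        have "(norm (grad e z))\<^sup>2 * (norm (grad e z))\<^sup>2 \<le> (?G t)\<^sup>2 * (norm (grad e z))\<^sup>2"
          using mx[OF that(1)] grad_on_tri[OF eN that] by (intro mult_right_mono power_mono) auto
        then show ?thesis by (simp add: power_add[symmetric])
      qed
    qed (intro pw_mult pw_const pw_grad[OF eN])+
    then show ?thesis by (simp add: S_def)
  qed
  show ?thesis
  proof (cases "slope e t = 0")
    case True
    have "0 \<le> 4 / 9 * C * S\<^sup>2" using C by simp
    then show ?thesis using Q_le True by (simp add: S_def)
  next
    case False
    \<comment> \<open>For \<open>n = 2\<close> all nodes are identified and \<open>e\<close> has
      slope zero. For larger \<open>n\<close> neighbouring nodes stay distinct modulo
      \<open>n - 1\<close>, so the hat below vanishes at the other two vertices of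
      \<open>t\<close>.\<close>
    have n3: "n \<noteq> 2"
    proof
      assume n2: "n = 2"
      define e0 where "e0 = e (x 0, y 0)"
      have "e (x i, y j) = e0" if "i < n" "j < n" for i j
        using X_NP_node_mod[OF e that] n2 by (simp add: e0_def)
      then have "slope e t = 0" using node_bounds[OF t(1)] by (simp add: slope_def zero_prod_def)
      then show False using False by simp
    qed
    let ?c = "(rp t mod (n - 1), rq t mod (n - 1))"
    have c: "?c \<in> {..<n - 1} \<times> {..<n - 1}" using n_ge2 by auto
    obtain v where v: "v \<in> X_NP L \<T>" and vn: "\<forall>i<n - 1. \<forall>j<n - 1. v (x i, y j) = (if (i, j) = ?c then 1 else 0)"
      using hat[OF c] by blast
    note vN = X_NP_X_N[OF v]
    have val: "v (x i, y j) = (if (i mod (n - 1), j mod (n - 1)) = ?c then 1 else 0)" if "i < n" "j < n" for i j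
    proof -
      have "i mod (n - 1) < n - 1" "j mod (n - 1) < n - 1" using n_ge2 by simp_all
      then show ?thesis unfolding X_NP_node_mod[OF v that] using vn by blast
    qed
    have neq: "cp t mod (n - 1) \<noteq> rp t mod (n - 1)" "cq t mod (n - 1) \<noteq> rq t mod (n - 1)"
    proof -
      have suc: "Suc k mod (n - 1) \<noteq> k mod (n - 1)" for k
      proof (cases "Suc (k mod (n - 1)) = n - 1")
        case True
        then have "Suc k mod (n - 1) = 0" by (simp add: mod_Suc)
        then show ?thesis using True n3 n_ge2 by linarith
      next
        case False
        then have "Suc k mod (n - 1) = Suc (k mod (n - 1))" by (simp add: mod_Suc)
        then show ?thesis by linarith
      qed
      obtain i j s where "t = (i, j, s)" by (cases t)
      then show "cp t mod (n - 1) \<noteq> rp t mod (n - 1)" "cq t mod (n - 1) \<noteq> rq t mod (n - 1)"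
        using suc[of i] suc[of j] suc[of i, symmetric] suc[of j, symmetric] by (cases s; cases "d i j"; simp)+
    qed
    define a where "a = \<bar>la t * lb t\<bar>"
    have a_pos: "0 < a" using legs_nonzero[OF t(1)] by (simp add: a_def)
    have sl: "slope v t = (- 1 / la t, - 1 / lb t)"
      using neq node_bounds[OF t(1)] by (simp add: slope_def val)
    \<comment> \<open>The inequality of arithmetic and geometric means; \<open>2 / a\<close> is the
      reciprocal of the area of the triangle.\<close>
    have "2 / a \<le> (norm (slope v t))\<^sup>2"
      using sum_squares_bound[of "\<bar>1 / la t\<bar>" "\<bar>1 / lb t\<bar>"]
      by (simp add: sl norm_prod_def a_def abs_mult power_divide)
    then have "(2 / a)\<^sup>2 \<le> ((norm (slope v t))\<^sup>2)\<^sup>2" using a_pos by (intro power_mono) auto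
    then have "a / 2 * (2 / a)\<^sup>2 \<le> a / 2 * norm (slope v t) ^ 4" using a_pos by (intro mult_left_mono) auto
    also have "\<dots> \<le> (LINT z|lebesgue_on (Omega L). norm (grad v z) ^ 4)"
      using member_le_sum[of t TI "\<lambda>t. \<bar>la t * lb t\<bar> / 2 * norm (slope v t) ^ 4"] t(1)
      unfolding integral_grad[OF vN, of "\<lambda>g. norm g ^ 4"] a_def by simp
    also have "\<dots> \<le> C * (LINT z|lebesgue_on (Omega L). (v z)\<^sup>2)\<^sup>2" by (rule inv[OF vN])
    also have "\<dots> \<le> C * (2 / 3)\<^sup>2"
      using hat_mass[OF v h1 _ c] vn C by (intro mult_left_mono power_mono) auto
    finally have "a / 2 * (2 / a)\<^sup>2 \<le> C * (2 / 3)\<^sup>2" .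
    moreover have "a / 2 * (2 / a)\<^sup>2 = 2 / a" using a_pos by (simp add: power2_eq_square)
    ultimately have a_inv: "2 / a \<le> 4 / 9 * C" by (simp add: power2_eq_square)
    \<comment> \<open>The triangle \<open>t\<close> alone contributes its area times the maximal
      squared gradient to \<open>S\<close>.\<close>
    have "a / 2 * (?G t)\<^sup>2 \<le> S"
      using member_le_sum[of t TI "\<lambda>t. \<bar>la t * lb t\<bar> / 2 * (norm (slope e t))\<^sup>2"] t(1)
      unfolding S_def integral_grad[OF eN, of "\<lambda>g. (norm g)\<^sup>2"] a_def by simp
    then have G: "(?G t)\<^sup>2 \<le> 2 / a * S" using a_pos by (simp add: field_simps)
    have "0 \<le> S" unfolding S_def by simp
    have "(?G t)\<^sup>2 * S \<le> (4 / 9 * C * S) * S"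
      using G mult_right_mono[OF a_inv \<open>0 \<le> S\<close>] \<open>0 \<le> S\<close> by (intro mult_right_mono) linarith+
    then have "(?G t)\<^sup>2 * S \<le> 4 / 9 * C * S\<^sup>2" by (simp only: power2_eq_square mult.assoc)
    then show ?thesis using Q_le unfolding S_def[symmetric] by linarith
  qed
qed

end

section \<open>The bilinear and trilinear forms of the scheme\<close>

text \<open>Expansion of both vectors in the canonical basis. It allows each matrix of the scheme to
  be replaced by the form that it represents.\<close>

lemma bilinear_matrix:
  fixes F :: "real ^ 'k \<Rightarrow> real ^ 'k \<Rightarrow> real"
  assumes "\<And>b. linear (\<lambda>a. F a b)" "\<And>a. linear (F a)"
  shows "a \<bullet> ((\<chi> I J. F (axis I 1) (axis J 1)) *v b) = F a b"
proof -
  have "F a b = F (\<Sum>I\<in>UNIV. a $ I *\<^sub>R axis I 1) (\<Sum>J\<in>UNIV. b $ J *\<^sub>R axis J 1)"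
    using basis_expansion[of a] basis_expansion[of b] by (simp add: scalar_mult_eq_scaleR)
  also have "\<dots> = (\<Sum>I\<in>UNIV. a $ I * F (axis I 1) (\<Sum>J\<in>UNIV. b $ J *\<^sub>R axis J 1))"
    by (simp add: linear_sum[OF assms(1)] linear_cmul[OF assms(1)])
  also have "\<dots> = (\<Sum>I\<in>UNIV. \<Sum>J\<in>UNIV. a $ I * (b $ J * F (axis I 1) (axis J 1)))"
    by (simp add: linear_sum[OF assms(2)] linear_cmul[OF assms(2)] sum_distrib_left)
  also have "\<dots> = a \<bullet> ((\<chi> I J. F (axis I 1) (axis J 1)) *v b)"
    by (simp add: inner_vec_def matrix_vector_mult_def sum_distrib_left mult_ac)
  finally show ?thesis ..
qed

section \<open>Linear structure of the spaces and the Hoelder bound for convection\<close>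

context mesh
begin

lemma X_NP_zero: "(\<lambda>z. 0) \<in> X_NP L \<T>"
  unfolding X_NP_def X_N_def by (auto intro!: exI[of _ 0])

lemma X_N_add:
  assumes "u \<in> X_N L \<T>" "v \<in> X_N L \<T>" shows "(\<lambda>z. u z + v z) \<in> X_N L \<T>"
  unfolding X_N_def
proof (intro CollectI conjI ballI)
  show "continuous_on (Omega_bar L) (\<lambda>z. u z + v z)"
    using assms by (auto simp: X_N_def intro: continuous_intros)
  fix t assume "t \<in> \<T>"
  then obtain a b a' b' where "\<forall>z\<in>t. u z = a + b \<bullet> z" "\<forall>z\<in>t. v z = a' + b' \<bullet> z"
    using assms unfolding X_N_def by blast
  then show "\<exists>a b. \<forall>z\<in>t. u z + v z = a + b \<bullet> z"
    by (intro exI[of _ "a + a'"] exI[of _ "b + b'"]) (auto simp: inner_add_left)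
qed

lemma X_N_scale:
  assumes "u \<in> X_N L \<T>" shows "(\<lambda>z. c * u z) \<in> X_N L \<T>"
  unfolding X_N_def
proof (intro CollectI conjI ballI)
  show "continuous_on (Omega_bar L) (\<lambda>z. c * u z)"
    using assms by (auto simp: X_N_def intro: continuous_intros)
  fix t assume "t \<in> \<T>"
  then obtain a b where "\<forall>z\<in>t. u z = a + b \<bullet> z" using assms unfolding X_N_def by blast
  then show "\<exists>a b. \<forall>z\<in>t. c * u z = a + b \<bullet> z"
    by (intro exI[of _ "c * a"] exI[of _ "c *\<^sub>R b"]) (auto simp: algebra_simps)
qed

lemma X_NP_add: "u \<in> X_NP L \<T> \<Longrightarrow> v \<in> X_NP L \<T> \<Longrightarrow> (\<lambda>z. u z + v z) \<in> X_NP L \<T>"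
  unfolding X_NP_def using X_N_add[of u v] by simp

lemma X_NP_scale: "u \<in> X_NP L \<T> \<Longrightarrow> (\<lambda>z. c * u z) \<in> X_NP L \<T>"
  unfolding X_NP_def using X_N_scale[of u c] by simp

lemma X_NP_sum:
  "finite S \<Longrightarrow> (\<And>I. I \<in> S \<Longrightarrow> f I \<in> X_NP L \<T>) \<Longrightarrow> (\<lambda>z. \<Sum>I\<in>S. c I * f I z) \<in> X_NP L \<T>"
  by (induction S rule: finite_induct) (simp_all add: X_NP_zero X_NP_add X_NP_scale)

text \<open>Rules for \<open>grad\<close> such as additivity are available inside the triangles
  only, where the functions are affine; this suffices for equality of integrals.\<close>

lemma integral_tri_cong:
  fixes f g :: "plane \<Rightarrow> real"
  assumes "f \<in> borel_measurable (lebesgue_on (Omega L))" "g \<in> borel_measurable (lebesgue_on (Omega L))"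
    "\<And>t z. t \<in> TI \<Longrightarrow> z \<in> tri t \<Longrightarrow> f z = g z"
  shows "(LINT z|lebesgue_on (Omega L). f z) = (LINT z|lebesgue_on (Omega L). g z)"
  by (rule integral_cong_AE[OF assms(1,2)]) (use AE_tri assms(3) in \<open>auto elim!: eventually_mono\<close>)

lemma pw_Cauchy_Schwarz:
  assumes "pw f" "pw g"
  shows "\<bar>LINT z|lebesgue_on (Omega L). f z * g z\<bar> \<le>
    sqrt (LINT z|lebesgue_on (Omega L). (f z)\<^sup>2) * sqrt (LINT z|lebesgue_on (Omega L). (g z)\<^sup>2)"
  by (rule Cauchy_Schwarz_L2(2)) (intro pw_measurable pw_integral(1) pw_power assms)+

text \<open>The constant \<open>5/6\<close> is a rational bound for \<open>sqrt (2/3)\<close>; the elliptic equation halves it to the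
  \<open>5/12\<close> of the contraction estimate.\<close>

lemma convection_bound:
  assumes e: "e \<in> X_NP L \<T>" and v: "v \<in> X_N L \<T>" and w: "w \<in> X_N L \<T>" and h1: "mesh_size \<T> < 1"
    and hat: "\<And>c. c \<in> {..<n - 1} \<times> {..<n - 1} \<Longrightarrow>
      \<exists>v\<in>X_NP L \<T>. \<forall>i<n - 1. \<forall>j<n - 1. v (x i, y j) = (if (i, j) = c then 1 else 0)"
    and inv: "\<And>v. v \<in> X_N L \<T> \<Longrightarrow>
      (LINT z|lebesgue_on (Omega L). norm (grad v z) ^ 4) \<le> D\<^sup>2 * (LINT z|lebesgue_on (Omega L). (v z)\<^sup>2)\<^sup>2"
    and D: "0 \<le> D"
  shows "\<bar>LINT z|lebesgue_on (Omega L). (rot90 (grad e z) \<bullet> grad v z) * w z\<bar> \<le>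
    5 / 6 * D * sqrt (LINT z|lebesgue_on (Omega L). (norm (grad e z))\<^sup>2) *
      sqrt (LINT z|lebesgue_on (Omega L). (v z)\<^sup>2) * sqrt (LINT z|lebesgue_on (Omega L). (w z)\<^sup>2)"
proof -
  note eN = X_NP_X_N[OF e]
  let ?I = "\<lambda>f. (LINT z|lebesgue_on (Omega L). f z)"
  let ?E = "?I (\<lambda>z. (norm (grad e z))\<^sup>2)" and ?V = "?I (\<lambda>z. (v z)\<^sup>2)"
  have nn: "0 \<le> ?E" "0 \<le> ?V" by simp_all
  \<comment> \<open>Two applications of the Cauchy-Schwarz inequality give the Hoelder estimate with
    exponents 4, 4 and 2; the present integral carries the two gradients.\<close>
  have "?I (\<lambda>z. (rot90 (grad e z) \<bullet> grad v z)\<^sup>2) \<le> ?I (\<lambda>z. (norm (grad e z))\<^sup>2 * (norm (grad v z))\<^sup>2)"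
  proof (rule pw_integral_mono)
    show "pw (\<lambda>z. (rot90 (grad e z) \<bullet> grad v z)\<^sup>2)" by (intro pw_power pw_grad2[OF eN v])
    show "pw (\<lambda>z. (norm (grad e z))\<^sup>2 * (norm (grad v z))\<^sup>2)" by (rule pw_grad2[OF eN v])
    fix z
    have "\<bar>rot90 (grad e z) \<bullet> grad v z\<bar> \<le> norm (grad e z) * norm (grad v z)"
      using Cauchy_Schwarz_ineq2[of "rot90 (grad e z)" "grad v z"] by (simp add: norm_rot90)
    then have "\<bar>rot90 (grad e z) \<bullet> grad v z\<bar>\<^sup>2 \<le> (norm (grad e z) * norm (grad v z))\<^sup>2" by (rule power_mono) simp
    then show "(rot90 (grad e z) \<bullet> grad v z)\<^sup>2 \<le> (norm (grad e z))\<^sup>2 * (norm (grad v z))\<^sup>2"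
      by (simp add: power_mult_distrib)
  qed
  also have "\<dots> \<le> sqrt (?I (\<lambda>z. ((norm (grad e z))\<^sup>2)\<^sup>2)) * sqrt (?I (\<lambda>z. ((norm (grad v z))\<^sup>2)\<^sup>2))"
    using pw_Cauchy_Schwarz[OF pw_grad[OF eN, of "\<lambda>g. (norm g)\<^sup>2"] pw_grad[OF v, of "\<lambda>g. (norm g)\<^sup>2"]] by linarith
  also have "\<dots> = sqrt (?I (\<lambda>z. norm (grad e z) ^ 4)) * sqrt (?I (\<lambda>z. norm (grad v z) ^ 4))"
    by simp
  \<comment> \<open>The sharpened bound is used for \<open>e\<close>, the plain inverse inequality
    for \<open>v\<close>.\<close>
  also have "\<dots> \<le> sqrt (4 / 9 * D\<^sup>2 * ?E\<^sup>2) * sqrt (D\<^sup>2 * ?V\<^sup>2)"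
    by (intro mult_mono real_sqrt_le_mono gradient_L4_bound[OF e h1 hat inv] inv[OF v]) simp_all
  also have "\<dots> = sqrt ((2 / 3 * D * ?E)\<^sup>2) * sqrt ((D * ?V)\<^sup>2)"
    by (simp add: power_mult_distrib power_divide)
  also have "\<dots> = 2 / 3 * (D\<^sup>2 * ?E * ?V)"
    using D nn by (simp only: real_sqrt_abs) (simp add: abs_mult power2_eq_square)
  also have "\<dots> \<le> (5 / 6)\<^sup>2 * (D\<^sup>2 * ?E * ?V)"
    using D nn by (intro mult_right_mono) (simp_all add: power2_eq_square)
  finally have "sqrt (?I (\<lambda>z. (rot90 (grad e z) \<bullet> grad v z)\<^sup>2)) \<le> sqrt ((5 / 6)\<^sup>2 * (D\<^sup>2 * ?E * ?V))"
    by (rule real_sqrt_le_mono)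
  also have "\<dots> = 5 / 6 * D * sqrt ?E * sqrt ?V"
    using D by (simp add: real_sqrt_mult)
  finally have "sqrt (?I (\<lambda>z. (rot90 (grad e z) \<bullet> grad v z)\<^sup>2)) * sqrt (?I (\<lambda>z. (w z)\<^sup>2))
     \<le> 5 / 6 * D * sqrt ?E * sqrt ?V * sqrt (?I (\<lambda>z. (w z)\<^sup>2))"
    by (rule mult_right_mono) simp
  then show ?thesis
    using pw_Cauchy_Schwarz[OF pw_grad2[OF eN v, of "\<lambda>a b. rot90 a \<bullet> b"] pw_X_N[OF w]] by linarith
qed

end

section \<open>Matrices of the scheme as forms on coefficient vectors\<close>

locale fe_space = mesh +
  fixes \<nu> :: "'k::finite \<Rightarrow> nat \<times> nat" and \<phi> :: "'k \<Rightarrow> plane \<Rightarrow> real"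
  assumes basis: "nodal_basis L n x y \<T> \<nu> \<phi>"
begin

abbreviation fe :: "real ^ 'k \<Rightarrow> plane \<Rightarrow> real" where "fe \<equiv> fe_fun \<phi>"

lemma fe_X_NP: "fe a \<in> X_NP L \<T>"
  unfolding fe_fun_def using basis by (intro X_NP_sum) (auto simp: nodal_basis_def)

lemma fe_X_N: "fe a \<in> X_N L \<T>"
  using fe_X_NP X_NP_X_N by blast

lemma fe_add: "fe (a + b) z = fe a z + fe b z"
  by (simp add: fe_fun_def sum.distrib algebra_simps)

lemma fe_diff: "fe (a - b) z = fe a z - fe b z"
  by (simp add: fe_fun_def sum_subtractf algebra_simps)

lemma fe_scale: "fe (c *\<^sub>R a) z = c * fe a z"
  by (simp add: fe_fun_def sum_distrib_left algebra_simps)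

lemma fe_axis: "fe (axis I 1) = \<phi> I"
proof
  fix z
  have "fe (axis I 1) z = (\<Sum>J\<in>UNIV. if J = I then \<phi> J z else 0)"
    unfolding fe_fun_def by (intro sum.cong refl) (simp add: axis_def)
  then show "fe (axis I 1) z = \<phi> I z" by simp
qed

lemma fe_node: "fe a (x (fst (\<nu> J)), y (snd (\<nu> J))) = a $ J"
proof -
  have "fe a (x (fst (\<nu> J)), y (snd (\<nu> J))) = (\<Sum>I\<in>UNIV. if I = J then a $ I else 0)"
    unfolding fe_fun_def using basis by (intro sum.cong refl) (simp add: nodal_basis_def)
  then show ?thesis by simp
qed

lemma \<nu>_range: "\<nu> I \<in> {..<n - 1} \<times> {..<n - 1}"
  using basis by (auto simp: nodal_basis_def bij_betw_def)

lemma hat_exists: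
  assumes "c \<in> {..<n - 1} \<times> {..<n - 1}"
  shows "\<exists>v\<in>X_NP L \<T>. \<forall>i<n - 1. \<forall>j<n - 1. v (x i, y j) = (if (i, j) = c then 1 else 0)"
proof -
  have surj: "\<nu> ` UNIV = {..<n - 1} \<times> {..<n - 1}" using basis by (auto simp: nodal_basis_def bij_betw_def)
  obtain I where I: "\<nu> I = c" using assms surj by (metis imageE)
  have "\<phi> I (x i, y j) = (if (i, j) = c then 1 else 0)" if ij: "i < n - 1" "j < n - 1" for i j
  proof -
    have "(i, j) \<in> \<nu> ` UNIV" using ij surj by simp
    then obtain J where J: "\<nu> J = (i, j)" by (metis imageE)
    have "\<phi> I (x (fst (\<nu> J)), y (snd (\<nu> J))) = (if I = J then 1 else 0)" using basis by (simp add: nodal_basis_def)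
    moreover have "I = J \<longleftrightarrow> \<nu> I = \<nu> J" using basis by (auto simp: nodal_basis_def bij_betw_def inj_def)
    ultimately show ?thesis using J I by auto
  qed
  moreover have "\<phi> I \<in> X_NP L \<T>" using basis by (simp add: nodal_basis_def)
  ultimately show ?thesis by blast
qed

definition mf :: "real ^ 'k \<Rightarrow> real ^ 'k \<Rightarrow> real" where
  "mf a b = (LINT z|lebesgue_on (Omega L). fe a z * fe b z)"

definition gf :: "real ^ 'k \<Rightarrow> real ^ 'k \<Rightarrow> real" where
  "gf a b = (LINT z|lebesgue_on (Omega L). grad (fe a) z \<bullet> grad (fe b) z)"

text \<open>The convection form, with the sign opposite to that of the matrix: \<open>S_mat\<close>
  at \<open>u\<close> represents \<open>- sf u\<close>.\<close>

definition sf :: "real ^ 'k \<Rightarrow> real ^ 'k \<Rightarrow> real ^ 'k \<Rightarrow> real" where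
  "sf u a b = (LINT z|lebesgue_on (Omega L). (rot90 (grad (fe u) z) \<bullet> grad (fe a) z) * fe b z)"

definition nrm :: "real ^ 'k \<Rightarrow> real" where
  "nrm a = norm2 L (fe a)"

lemma slope_add: "slope (fe (a + b)) t = slope (fe a) t + slope (fe b) t"
  by (simp add: slope_def fe_add diff_divide_distrib add_divide_distrib)

lemma slope_scale: "slope (fe (c *\<^sub>R a)) t = c *\<^sub>R slope (fe a) t"
  by (simp add: slope_def fe_scale diff_divide_distrib right_diff_distrib)

lemma grad_fe_add: "t \<in> TI \<Longrightarrow> z \<in> tri t \<Longrightarrow> grad (fe (a + b)) z = grad (fe a) z + grad (fe b) z"
  by (simp add: grad_on_tri[OF fe_X_N] slope_add)

lemma grad_fe_scale: "t \<in> TI \<Longrightarrow> z \<in> tri t \<Longrightarrow> grad (fe (c *\<^sub>R a)) z = c *\<^sub>R grad (fe a) z"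
  by (simp add: grad_on_tri[OF fe_X_N] slope_scale)

lemma pw_fe: "pw (fe a)"
  by (intro pw_X_N fe_X_N)

lemma pw_inner_grad: "pw (\<lambda>z. grad (fe a) z \<bullet> grad (fe b) z)"
  by (rule pw_grad2[OF fe_X_N fe_X_N])

lemma pw_inner_rot_grad: "pw (\<lambda>z. rot90 (grad (fe a) z) \<bullet> grad (fe b) z)"
  by (rule pw_grad2[OF fe_X_N fe_X_N])

lemma linear_LINT:
  assumes int: "\<And>a. integrable (lebesgue_on (Omega L)) (f a)"
    and add: "\<And>a b t z. t \<in> TI \<Longrightarrow> z \<in> tri t \<Longrightarrow> f (a + b) z = f a z + f b z"
    and scale: "\<And>c a t z. t \<in> TI \<Longrightarrow> z \<in> tri t \<Longrightarrow> f (c *\<^sub>R a) z = c * f a z"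
  shows "linear (\<lambda>a :: 'v::real_vector. LINT z|lebesgue_on (Omega L). f a z)"
proof (rule linearI)
  fix a b :: 'v
  have "(LINT z|lebesgue_on (Omega L). f (a + b) z) = (LINT z|lebesgue_on (Omega L). f a z + f b z)"
    by (rule integral_tri_cong) (simp_all add: borel_measurable_integrable int add)
  then show "(LINT z|lebesgue_on (Omega L). f (a + b) z) =
      (LINT z|lebesgue_on (Omega L). f a z) + (LINT z|lebesgue_on (Omega L). f b z)"
    using int by simp
next
  fix c and a :: 'v
  have "(LINT z|lebesgue_on (Omega L). f (c *\<^sub>R a) z) = (LINT z|lebesgue_on (Omega L). c * f a z)"
    by (rule integral_tri_cong) (simp_all add: borel_measurable_integrable int scale)
  then show "(LINT z|lebesgue_on (Omega L). f (c *\<^sub>R a) z) = c *\<^sub>R (LINT z|lebesgue_on (Omega L). f a z)"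
    by simp
qed

lemmas linear_LINT_pw = linear_LINT[OF pw_integral(1)]

lemma linear_mf1: "linear (\<lambda>a. mf a b)"
  unfolding mf_def
  by (rule linear_LINT_pw) (simp_all add: pw_mult pw_fe fe_add fe_scale distrib_right)

lemma mf_commute: "mf a b = mf b a"
  by (simp add: mf_def mult.commute)

lemma linear_mf2: "linear (mf a)"
proof -
  have "mf a = (\<lambda>b. mf b a)" by (rule ext) (rule mf_commute)
  then show ?thesis using linear_mf1[of a] by simp
qed

lemma linear_gf1: "linear (\<lambda>a. gf a b)"
  unfolding gf_def
  by (rule linear_LINT_pw) (simp_all add: pw_inner_grad grad_fe_add grad_fe_scale inner_add_left)

lemma linear_gf2: "linear (\<lambda>b. gf a b)"
  unfolding gf_def
  by (rule linear_LINT_pw) (simp_all add: pw_inner_grad grad_fe_add grad_fe_scale inner_add_right)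

lemma rot90_add: "rot90 (g + g') = rot90 g + rot90 g'" and rot90_scale: "rot90 (c *\<^sub>R g) = c *\<^sub>R rot90 g"
  by (simp_all add: rot90_def)

lemma linear_sf1: "linear (\<lambda>u. sf u a b)"
  unfolding sf_def
  by (rule linear_LINT_pw)
     (simp_all add: pw_mult pw_fe pw_inner_rot_grad grad_fe_add grad_fe_scale rot90_add rot90_scale
       inner_add_left distrib_right)

lemma linear_sf2: "linear (\<lambda>a. sf u a b)"
  unfolding sf_def
  by (rule linear_LINT_pw)
     (simp_all add: pw_mult pw_fe pw_inner_rot_grad grad_fe_add grad_fe_scale inner_add_right distrib_right)

lemma linear_sf3: "linear (\<lambda>b. sf u a b)"
  unfolding sf_def
  by (rule linear_LINT_pw)
     (simp_all add: pw_mult pw_fe pw_inner_rot_grad fe_add fe_scale distrib_left)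

lemma inner_M: "a \<bullet> (M_mat L \<phi> *v b) = mf a b"
  using bilinear_matrix[of mf a b, OF linear_mf1 linear_mf2]
  by (simp add: M_mat_def mf_def ip2_def fe_axis)

lemma inner_K: "a \<bullet> (K_mat L \<phi> *v b) = mf a b + gf a b"
proof -
  have "linear (\<lambda>a. mf a b + gf a b)" for b by (intro linear_compose_add linear_mf1 linear_gf1)
  moreover have "linear (\<lambda>b. mf a b + gf a b)" for a by (intro linear_compose_add linear_mf2 linear_gf2)
  ultimately show ?thesis
    using bilinear_matrix[of "\<lambda>a b. mf a b + gf a b" a b]
    by (simp add: K_mat_def mf_def gf_def ip2_def ipH1_def fe_axis)
qed

lemma inner_S: "a \<bullet> (S_mat L \<phi> u *v b) = - sf u a b"
proof -
  have "linear (\<lambda>a. - sf u a b)" for b by (intro linear_compose_neg linear_sf2)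
  moreover have "linear (\<lambda>b. - sf u a b)" for a by (intro linear_compose_neg linear_sf3)
  ultimately show ?thesis
    using bilinear_matrix[of "\<lambda>a b. - sf u a b" a b]
    by (simp add: S_mat_def sf_def ip2_def fe_axis)
qed

text \<open>By linearity of \<open>sf\<close> in its first argument, the columns
  \<open>S(e\<^sub>J) w\<close> combine to \<open>S(u) w\<close>. Hence the upper block row of the
  chord matrix contains the derivative of \<open>S(U) W\<close> at the starting point.\<close>

lemma B_mat_mult: "B_mat L \<phi> w *v u = S_mat L \<phi> u *v w"
proof -
  have "(B_mat L \<phi> w *v u) $ I = (S_mat L \<phi> u *v w) $ I" for I
  proof -
    have comp: "(S_mat L \<phi> u *v w) $ I = - sf u (axis I 1) w" for u
      using inner_S[of "axis I 1" u w] by (simp add: inner_axis')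
    have mv: "(A *v u) $ I = (\<Sum>J\<in>UNIV. A $ I $ J * u $ J)" for A :: "real ^ 'k ^ 'k"
      by (simp add: matrix_vector_mult_def)
    have "- sf u (axis I 1) w = - sf (\<Sum>J\<in>UNIV. u $ J *\<^sub>R axis J 1) (axis I 1) w"
      using basis_expansion[of u] by (simp add: scalar_mult_eq_scaleR)
    also have "\<dots> = (\<Sum>J\<in>UNIV. - sf (axis J 1) (axis I 1) w * u $ J)"
      by (simp add: linear_sum[OF linear_sf1] linear_cmul[OF linear_sf1] sum_negf mult.commute)
    also have "\<dots> = (B_mat L \<phi> w *v u) $ I"
      unfolding mv B_mat_def by (simp add: comp[symmetric])
    finally show ?thesis by (simp add: comp)
  qed
  then show ?thesis by (simp add: vec_eq_iff)
qed

lemma sf_skew: "sf u a a = 0"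
  unfolding sf_def by (rule convection_skew[OF fe_X_NP fe_X_NP])

lemma nrm_sq: "(nrm a)\<^sup>2 = mf a a"
  by (simp add: nrm_def norm2_def ip2_def mf_def power2_eq_square[symmetric] real_sqrt_pow2_iff)

lemma nrm_eq_sqrt: "nrm a = sqrt (LINT z|lebesgue_on (Omega L). (fe a z)\<^sup>2)"
  by (simp add: nrm_def norm2_def ip2_def power2_eq_square)

lemma nrm_nonneg: "0 \<le> nrm a"
  by (simp add: nrm_eq_sqrt)

lemma mf_le: "\<bar>mf a b\<bar> \<le> nrm a * nrm b"
  unfolding mf_def nrm_eq_sqrt by (rule pw_Cauchy_Schwarz) (intro pw_X_N fe_X_N)+

lemma nrm_triangle: "nrm (a + b) \<le> nrm a + nrm b"
proof (rule power2_le_imp_le)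
  have "(nrm (a + b))\<^sup>2 = (nrm a)\<^sup>2 + 2 * mf a b + (nrm b)\<^sup>2"
    by (simp add: nrm_sq linear_add[OF linear_mf1] linear_add[OF linear_mf2] mf_commute[of b a])
  then show "(nrm (a + b))\<^sup>2 \<le> (nrm a + nrm b)\<^sup>2"
    using mf_le[of a b] by (simp add: power2_sum)
qed (simp add: nrm_nonneg)

lemma nrm_minus: "nrm (a - b) = nrm (b - a)"
  by (simp add: nrm_eq_sqrt fe_diff power2_commute)

text \<open>The function vanishes on the closed square, in particular at the nodes, where its values
  are the coefficients.\<close>

lemma nrm_zero: assumes "nrm a = 0" shows "a = 0"
proof -
  have "(LINT z|lebesgue_on (Omega L). (fe a z)\<^sup>2) = 0" using assms by (simp add: nrm_eq_sqrt)
  then have z: "fe a w = 0" if "w \<in> Omega_bar L" for w using X_N_zero[OF fe_X_N _ that] by blast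
  have "a $ J = 0" for J
  proof -
    have "fst (\<nu> J) < n" "snd (\<nu> J) < n" using \<nu>_range[of J] by (auto simp: mem_Times_iff)
    then have "(x (fst (\<nu> J)), y (snd (\<nu> J))) \<in> Omega_bar L"
      using x_range y_range by (simp add: Omega_bar_def)
    then show ?thesis using z fe_node by metis
  qed
  then show ?thesis by (simp add: vec_eq_iff)
qed

lemma gf_nonneg: "0 \<le> gf a a"
  by (simp add: gf_def)

text \<open>Testing with \<open>e\<close> gives \<open>\<parallel>e\<parallel>\<^sup>2 +
  \<parallel>\<nabla>e\<parallel>\<^sup>2 \<le> \<parallel>e\<parallel>
  \<parallel>f\<parallel>\<close>. Dropping the gradient yields the first bound; completing the
  square yields the second and its factor \<open>1 / 2\<close>.\<close>

lemma elliptic: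
  assumes "K_mat L \<phi> *v e = M_mat L \<phi> *v f"
  shows "nrm e \<le> nrm f" "sqrt (gf e e) \<le> nrm f / 2"
proof -
  have "(nrm e)\<^sup>2 + gf e e = mf e f"
    using inner_K[of e e] inner_M[of e f] assms by (simp add: nrm_sq)
  also have "\<dots> \<le> nrm e * nrm f" using mf_le[of e f] by linarith
  finally have *: "(nrm e)\<^sup>2 + gf e e \<le> nrm e * nrm f" .
  show "nrm e \<le> nrm f"
  proof (cases "nrm e = 0")
    case True
    then show ?thesis using nrm_nonneg by simp
  next
    case False
    then have "0 < nrm e" using nrm_nonneg[of e] by simp
    moreover have "nrm e * nrm e \<le> nrm e * nrm f" using * gf_nonneg[of e] by (simp add: power2_eq_square)
    ultimately show ?thesis by simp
  qed
  have "0 \<le> (nrm e - nrm f / 2)\<^sup>2" by simp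
  then have "gf e e \<le> (nrm f / 2)\<^sup>2" using * by (simp add: power2_diff power_divide)
  then have "sqrt (gf e e) \<le> sqrt ((nrm f / 2)\<^sup>2)" by (rule real_sqrt_le_mono)
  then show "sqrt (gf e e) \<le> nrm f / 2" using nrm_nonneg[of f] by simp
qed

end

text \<open>The worst case is \<open>w = 1 - 2 * u\<close>. At \<open>u = 0\<close> the two sides of
  the second claim are then \<open>25 / 48\<close> and \<open>21 / 40\<close>, so the factor
  \<open>9 / 10\<close> is only just large enough.\<close>

lemma contraction_arith:
  fixes u w :: real
  assumes "0 \<le> u" "u \<le> 1 / 6" "0 \<le> w" "w \<le> 1 - 2 * u"
  shows "0 < 1 - u - 5 / 12 * w"
    and "3 * (5 / 12) * w * (u + 5 / 12 * w) \<le> 9 / 10 * (1 - u - 5 / 12 * w)"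
proof -
  show "0 < 1 - u - 5 / 12 * w" using assms by linarith
  have "w * (u + 5 / 12 * w) \<le> (1 - 2 * u) * (u + 5 / 12 * (1 - 2 * u))"
    using assms by (intro mult_mono) auto
  also have "\<dots> = 5 / 12 - 2 / 3 * u - 1 / 3 * u\<^sup>2" by (simp add: power2_eq_square field_simps)
  also have "\<dots> \<le> 5 / 12 - 2 / 3 * u" by simp
  finally have "w * (u + 5 / 12 * w) \<le> 5 / 12 - 2 / 3 * u" .
  then show "3 * (5 / 12) * w * (u + 5 / 12 * w) \<le> 9 / 10 * (1 - u - 5 / 12 * w)"
    using assms by simp
qed

lemma block_mult_vec:
  fixes A B C D :: "real ^ 'a ^ 'a::finite"
  shows "block_mat A B C D *v block_vec u w = block_vec (A *v u + B *v w) (C *v u + D *v w)"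
proof -
  have sum_Plus: "(\<Sum>i\<in>UNIV. f i) = (\<Sum>i\<in>UNIV. f (Inl i)) + (\<Sum>i\<in>UNIV. f (Inr i))"
    for f :: "'a + 'a \<Rightarrow> real"
    using sum.Plus[of "UNIV :: 'a set" "UNIV :: 'a set" f] by simp
  have "(block_mat A B C D *v block_vec u w) $ i = block_vec (A *v u + B *v w) (C *v u + D *v w) $ i" for i
    by (cases i) (simp_all add: block_mat_def block_vec_def matrix_vector_mult_def sum_Plus)
  then show ?thesis by (simp add: vec_eq_iff)
qed

lemma block_vec_inject: "block_vec u w = block_vec u' w' \<longleftrightarrow> u = u' \<and> w = w'"
proof
  assume eq: "block_vec u w = block_vec u' w'"
  have "u $ i = u' $ i" for i using arg_cong[OF eq, of "\<lambda>v. v $ Inl i"] by (simp add: block_vec_def)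
  moreover have "w $ i = w' $ i" for i using arg_cong[OF eq, of "\<lambda>v. v $ Inr i"] by (simp add: block_vec_def)
  ultimately show "u = u' \<and> w = w'" by (simp add: vec_eq_iff)
qed simp

section \<open>Essentially bounded coefficients on the square\<close>

context mesh
begin

text \<open>Positive measure ensures that the essential supremum of the zero function is zero rather
  than minus infinity.\<close>

lemma emeasure_Omega: "emeasure (lebesgue_on (Omega L)) (space (lebesgue_on (Omega L))) \<noteq> 0"
proof
  assume "emeasure (lebesgue_on (Omega L)) (space (lebesgue_on (Omega L))) = 0"
  then have "Omega L \<in> null_sets lebesgue"
    by (intro null_setsI) (simp_all add: emeasure_restrict_space)
  then have "negligible (Omega L)" by (simp add: negligible_iff_null_sets)
  moreover have "(L / 2, L / 2) \<in> Omega L" using L_pos by (simp add: Omega_def)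
  ultimately show False using open_not_negligible[OF open_Omega] by blast
qed

lemma finite_Omega: "finite_measure (lebesgue_on (Omega L))"
proof
  have "Omega L \<in> lmeasurable"
    by (rule bounded_set_imp_lmeasurable[OF _ Omega_measurable])
       (auto simp: Omega_def intro!: bounded_Times)
  then show "emeasure (lebesgue_on (Omega L)) (space (lebesgue_on (Omega L))) \<noteq> \<infinity>"
    by (simp add: emeasure_restrict_space fmeasurable_def)
qed

text \<open>\<open>norm_inf\<close> passes through \<open>real_of_ereal\<close>, so the essential
  supremum must first be shown to be finite.\<close>

lemma Linf_bound:
  assumes "f \<in> Linf_space L"
  shows "AE z in lebesgue_on (Omega L). \<bar>f z\<bar> \<le> norm_inf L f" "0 \<le> norm_inf L f"
proof -
  let ?M = "lebesgue_on (Omega L)"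
  let ?s = "esssup ?M (\<lambda>z. ereal \<bar>f z\<bar>)"
  have m [measurable]: "f \<in> borel_measurable ?M" using assms by (simp add: Linf_space_def)
  obtain C where "AE z in ?M. \<bar>f z\<bar> \<le> C" using assms by (auto simp: Linf_space_def)
  then have up: "?s \<le> ereal C" by (intro esssup_I) auto
  have "esssup ?M (\<lambda>z. 0 :: ereal) \<le> ?s" by (rule esssup_mono) auto
  then have lo: "0 \<le> ?s" using esssup_const[OF emeasure_Omega, of "0 :: ereal"] by simp
  then show "0 \<le> norm_inf L f" by (simp add: norm_inf_def real_of_ereal_pos)
  have fin: "ereal (norm_inf L f) = ?s" using up lo by (cases ?s) (auto simp: norm_inf_def)
  show "AE z in ?M. \<bar>f z\<bar> \<le> norm_inf L f"
    using esssup_AE[of "\<lambda>z. ereal \<bar>f z\<bar>" ?M] unfolding fin[symmetric] by simp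
qed

text \<open>On a set of finite measure a bounded function is square integrable, and the product of
  two square integrable functions is integrable.\<close>

lemma Linf_times_pw:
  assumes f: "f \<in> Linf_space L" and g: "pw g"
  shows "integrable (lebesgue_on (Omega L)) (\<lambda>z. f z * g z)"
proof (rule Cauchy_Schwarz_L2(1))
  show m: "f \<in> borel_measurable (lebesgue_on (Omega L))" using f by (simp add: Linf_space_def)
  have "AE z in lebesgue_on (Omega L). norm ((f z)\<^sup>2) \<le> (norm_inf L f)\<^sup>2"
    using Linf_bound(1)[OF f]
  proof eventually_elim
    case (elim z)
    from power_mono[OF elim, of 2] show ?case by simp
  qed
  then show "integrable (lebesgue_on (Omega L)) (\<lambda>z. (f z)\<^sup>2)"
    by (intro finite_measure.integrable_const_bound[OF finite_Omega]) (use m in auto)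
qed (intro pw_measurable pw_integral(1) pw_power g)+

end

section \<open>The form of the coefficient \<open>p\<close> and a priori bounds for the
  scheme\<close>

context fe_space
begin

context
  fixes p :: "plane \<Rightarrow> real" and q :: "plane \<Rightarrow> plane"
  assumes pq: "W1inf_with_gradient L p q"
begin

definition rf :: "real ^ 'k \<Rightarrow> real ^ 'k \<Rightarrow> real" where
  "rf u a = (LINT z|lebesgue_on (Omega L). (rot90 (q z) \<bullet> grad (fe u) z) * fe a z)"

lemma norm_1inf_nonneg: "0 \<le> norm_1inf L p q"
  using pq Linf_bound(2)[of p] by (simp add: W1inf_with_gradient_def norm_1inf_def le_max_iff_disj)

lemma q_Linf: "(\<lambda>z. fst (q z)) \<in> Linf_space L" "(\<lambda>z. snd (q z)) \<in> Linf_space L"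
  using pq by (simp_all add: W1inf_with_gradient_def)

lemma q_bound:
  "AE z in lebesgue_on (Omega L). \<bar>fst (q z)\<bar> \<le> norm_1inf L p q \<and> \<bar>snd (q z)\<bar> \<le> norm_1inf L p q"
  using Linf_bound(1)[OF q_Linf(1)] Linf_bound(1)[OF q_Linf(2)]
  by eventually_elim (simp add: norm_1inf_def le_max_iff_disj)

lemma rot90_inner: "rot90 g \<bullet> g' = fst g * snd g' + snd g * (- fst g')"
  by (simp add: rot90_def inner_prod_def)

lemma pw_grad_comp: "pw (\<lambda>z. fst (grad (fe u) z))" "pw (\<lambda>z. snd (grad (fe u) z))" "pw (\<lambda>z. - fst (grad (fe u) z))"
  by (rule pw_grad[OF fe_X_N])+

lemma rf_integrable: "integrable (lebesgue_on (Omega L)) (\<lambda>z. (rot90 (q z) \<bullet> grad (fe u) z) * fe a z)"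
proof -
  have "integrable (lebesgue_on (Omega L)) (\<lambda>z. fst (q z) * (snd (grad (fe u) z) * fe a z)
      + snd (q z) * (- fst (grad (fe u) z) * fe a z))"
    by (intro Bochner_Integration.integrable_add Linf_times_pw q_Linf pw_mult pw_grad_comp pw_fe)
  then show ?thesis by (simp add: rot90_inner algebra_simps)
qed

lemma linear_rf1: "linear (\<lambda>u. rf u a)"
  unfolding rf_def
  by (rule linear_LINT) (simp_all add: rf_integrable grad_fe_add grad_fe_scale inner_add_right distrib_right)

lemma linear_rf2: "linear (\<lambda>a. rf u a)"
  unfolding rf_def
  by (rule linear_LINT) (simp_all add: rf_integrable fe_add fe_scale distrib_left)

lemma inner_R: "a \<bullet> (R_mat L q \<phi> *v u) = rf u a"
  using bilinear_matrix[of "\<lambda>a u. rf u a" a u, OF linear_rf2 linear_rf1]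
  by (simp add: R_mat_def rf_def ip2_def fe_axis)

text \<open>Pointwise, each of the two products in
  \<open>rot90 (q z) \<bullet> grad (fe u) z\<close> is at most the norm of \<open>p\<close> times
  the length of the gradient.\<close>

lemma rf_le: "\<bar>rf u a\<bar> \<le> 2 * norm_1inf L p q * sqrt (gf u u) * nrm a"
proof -
  let ?M = "lebesgue_on (Omega L)" and ?P = "norm_1inf L p q"
  let ?f = "\<lambda>z. rot90 (q z) \<bullet> grad (fe u) z"
  have [measurable]: "(\<lambda>z. fst (q z)) \<in> borel_measurable ?M" "(\<lambda>z. snd (q z)) \<in> borel_measurable ?M"
    using q_Linf by (simp_all add: Linf_space_def)
  have [measurable]: "(\<lambda>z. snd (grad (fe u) z)) \<in> borel_measurable ?M" "(\<lambda>z. - fst (grad (fe u) z)) \<in> borel_measurable ?M"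
    by (rule pw_measurable, rule pw_grad_comp)+
  have m: "?f \<in> borel_measurable ?M" unfolding rot90_inner by measurable
  have g_int: "integrable ?M (\<lambda>z. (2 * ?P)\<^sup>2 * (grad (fe u) z \<bullet> grad (fe u) z))"
    by (intro pw_integral(1) pw_mult pw_const pw_inner_grad)
  have bound: "AE z in ?M. (?f z)\<^sup>2 \<le> (2 * ?P)\<^sup>2 * (grad (fe u) z \<bullet> grad (fe u) z)"
    using q_bound
  proof eventually_elim
    case (elim z)
    let ?g = "grad (fe u) z"
    have "\<bar>?f z\<bar> \<le> \<bar>fst (q z)\<bar> * \<bar>snd ?g\<bar> + \<bar>snd (q z)\<bar> * \<bar>fst ?g\<bar>"
      unfolding rot90_inner by (rule order.trans[OF abs_triangle_ineq]) (simp add: abs_mult)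
    also have "\<dots> \<le> ?P * norm ?g + ?P * norm ?g"
      using elim norm_fst_le[of "fst ?g" "snd ?g"] norm_snd_le[of "snd ?g" "fst ?g"] norm_1inf_nonneg
      by (intro add_mono mult_mono) auto
    finally have "\<bar>?f z\<bar>\<^sup>2 \<le> (2 * ?P * norm ?g)\<^sup>2" by (intro power_mono) auto
    then show ?case by (simp add: power_mult_distrib power2_norm_eq_inner)
  qed
  have f_int: "integrable ?M (\<lambda>z. (?f z)\<^sup>2)"
    by (rule Bochner_Integration.integrable_bound[OF g_int]) (use m bound in \<open>auto elim!: eventually_mono\<close>)
  have "(LINT z|?M. (?f z)\<^sup>2) \<le> (LINT z|?M. (2 * ?P)\<^sup>2 * (grad (fe u) z \<bullet> grad (fe u) z))"
    by (rule integral_mono_AE[OF f_int g_int bound])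
  then have "sqrt (LINT z|?M. (?f z)\<^sup>2) \<le> sqrt ((2 * ?P)\<^sup>2 * gf u u)"
    by (simp add: gf_def)
  also have "\<dots> = 2 * ?P * sqrt (gf u u)" using norm_1inf_nonneg by (simp add: real_sqrt_mult)
  finally have "sqrt (LINT z|?M. (?f z)\<^sup>2) * nrm a \<le> 2 * ?P * sqrt (gf u u) * nrm a"
    by (rule mult_right_mono) (rule nrm_nonneg)
  moreover have "\<bar>rf u a\<bar> \<le> sqrt (LINT z|?M. (?f z)\<^sup>2) * nrm a"
    unfolding rf_def nrm_eq_sqrt
    by (rule Cauchy_Schwarz_L2(2)[OF m f_int]) (intro pw_measurable pw_integral(1) pw_power pw_fe)+
  ultimately show ?thesis by linarith
qed

text \<open>The factor 2 of the general bound is cancelled by the \<open>1 / 2\<close> in the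
  gradient bound for elliptic potentials.\<close>

lemma rf_elliptic:
  assumes "K_mat L \<phi> *v e = M_mat L \<phi> *v f"
  shows "\<bar>rf e a\<bar> \<le> norm_1inf L p q * nrm f * nrm a"
proof -
  have "2 * norm_1inf L p q * sqrt (gf e e) * nrm a \<le> 2 * norm_1inf L p q * (nrm f / 2) * nrm a"
    by (intro mult_right_mono mult_left_mono elliptic(2)[OF assms]) (use norm_1inf_nonneg nrm_nonneg in auto)
  then show ?thesis using rf_le[of e a] by simp
qed

lemma implicit_test:
  assumes "implicit_step L q \<phi> \<tau> U0 W0 U' W'"
  shows "mf a W' - \<tau> * sf U' a W' - \<tau> * rf U' a = mf a W0"
proof -
  have "a \<bullet> ((M_mat L \<phi> + \<tau> *\<^sub>R S_mat L \<phi> U') *v W' - \<tau> *\<^sub>R (R_mat L q \<phi> *v U')) = a \<bullet> (M_mat L \<phi> *v W0)"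
    using assms by (simp add: implicit_step_def)
  then show ?thesis
    by (simp add: matrix_vector_mult_add_rdistrib scaleR_matrix_vector_assoc[symmetric] inner_add_right inner_diff_right
        inner_M inner_S inner_R)
qed

text \<open>Testing with \<open>W'\<close> removes convection by skew symmetry, and only the term
  with \<open>p\<close> can make the norm grow.\<close>

lemma implicit_stable:
  assumes st: "implicit_step L q \<phi> \<tau> U0 W0 U' W'" and "0 \<le> \<tau>"
  shows "nrm W' * (1 - \<tau> * norm_1inf L p q) \<le> nrm W0"
proof (cases "nrm W' = 0")
  case True
  then show ?thesis using nrm_nonneg by simp
next
  case False
  then have pos: "0 < nrm W'" using nrm_nonneg[of W'] by simp
  have K: "K_mat L \<phi> *v U' = M_mat L \<phi> *v W'" using st by (simp add: implicit_step_def)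
  have "nrm W' * nrm W' = mf W' W0 + \<tau> * rf U' W'"
    using implicit_test[OF st, of W'] by (simp add: sf_skew nrm_sq[symmetric] power2_eq_square)
  also have "\<dots> \<le> nrm W' * nrm W0 + \<tau> * (norm_1inf L p q * nrm W' * nrm W')"
    using mf_le[of W' W0] rf_elliptic[OF K, of W'] assms(2) by (intro add_mono mult_left_mono) auto
  finally have "nrm W' * (nrm W' * (1 - \<tau> * norm_1inf L p q)) \<le> nrm W' * nrm W0" by (simp add: algebra_simps)
  then show ?thesis using pos by simp
qed

text \<open>The projection does not increase the norm. With \<open>u\<close> the product of
  \<open>\<tau>\<close> and the norm of \<open>p\<close>, each step costs at most a factor
  \<open>1 / (1 - u) \<le> exp (3 * u)\<close>.\<close>

lemma implicit_exp_bound: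
  assumes sol: "implicit_solution L q \<T> \<phi> \<tau> w0 m U W" and w0: "w0 \<in> L2_space L"
    and "0 \<le> \<tau>" "\<tau> * norm_1inf L p q \<le> 1 / 6" "j \<le> m"
  shows "nrm (W j) \<le> exp (3 * (real j * (\<tau> * norm_1inf L p q))) * norm2 L w0"
  using \<open>j \<le> m\<close>
proof (induction j)
  case 0
  have "(nrm (W 0))\<^sup>2 = ip2 L w0 (fe (W 0))"
    using sol fe_X_NP[of "W 0"] by (simp add: implicit_solution_def nrm_sq mf_def ip2_def)
  also have "\<dots> \<le> norm2 L w0 * nrm (W 0)"
  proof -
    have "\<bar>ip2 L w0 (fe (W 0))\<bar> \<le> sqrt (LINT z|lebesgue_on (Omega L). (w0 z)\<^sup>2) * nrm (W 0)"
      unfolding ip2_def nrm_eq_sqrt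
      by (rule Cauchy_Schwarz_L2(2)) (use w0 in \<open>auto simp: L2_space_def intro: pw_measurable pw_integral(1) pw_power pw_fe\<close>)
    then show ?thesis by (simp add: norm2_def ip2_def power2_eq_square)
  qed
  finally have *: "nrm (W 0) * nrm (W 0) \<le> norm2 L w0 * nrm (W 0)" by (simp add: power2_eq_square)
  have "0 \<le> norm2 L w0" by (simp add: norm2_def ip2_def)
  then have "nrm (W 0) \<le> norm2 L w0"
    using * nrm_nonneg[of "W 0"] by (cases "nrm (W 0) = 0") auto
  then show ?case by simp
next
  case (Suc j)
  let ?u = "\<tau> * norm_1inf L p q"
  have u: "0 \<le> ?u" using assms(3) norm_1inf_nonneg by simp
  have "implicit_step L q \<phi> \<tau> (U j) (W j) (U (Suc j)) (W (Suc j))"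
    using sol Suc.prems by (simp add: implicit_solution_def)
  then have st: "nrm (W (Suc j)) * (1 - ?u) \<le> nrm (W j)" by (rule implicit_stable) (rule assms)
  \<comment> \<open>This is the excess of \<open>(1 - ?u) * (1 + 3 * ?u)\<close> over 1.\<close>
  have "0 \<le> ?u * (2 - 3 * ?u)" by (rule mult_nonneg_nonneg[OF u]) (use assms(4) in simp)
  then have "1 \<le> (1 - ?u) * (1 + 3 * ?u)" by (simp add: algebra_simps)
  also have "\<dots> \<le> (1 - ?u) * exp (3 * ?u)"
    using assms(4) exp_ge_add_one_self[of "3 * ?u"] by (intro mult_left_mono) auto
  finally have "nrm (W (Suc j)) * 1 \<le> nrm (W (Suc j)) * ((1 - ?u) * exp (3 * ?u))"
    by (intro mult_left_mono nrm_nonneg)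
  also have "\<dots> \<le> nrm (W j) * exp (3 * ?u)"
    using mult_right_mono[OF st, of "exp (3 * ?u)"] by (simp add: mult.assoc)
  also have "\<dots> \<le> exp (3 * (real j * ?u)) * norm2 L w0 * exp (3 * ?u)"
    using Suc by (intro mult_right_mono) auto
  also have "\<dots> = exp (3 * (real (Suc j) * ?u)) * norm2 L w0"
    by (simp add: exp_add[symmetric] algebra_simps)
  finally show ?case by simp
qed

end

end

section \<open>Convergence of the chord iterates\<close>

context fe_space
begin

context
  fixes D :: real
  assumes h1: "mesh_size \<T> < 1" and D_nonneg: "0 \<le> D"
    and inv: "\<And>v. v \<in> X_N L \<T> \<Longrightarrow>
      (LINT z|lebesgue_on (Omega L). norm (grad v z) ^ 4) \<le> D\<^sup>2 * (LINT z|lebesgue_on (Omega L). (v z)\<^sup>2)\<^sup>2"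
begin

lemma sf_elliptic:
  assumes "K_mat L \<phi> *v e = M_mat L \<phi> *v f"
  shows "\<bar>sf e a b\<bar> \<le> 5 / 12 * D * nrm f * nrm a * nrm b"
proof -
  have "\<bar>sf e a b\<bar> \<le> 5 / 6 * D * sqrt (gf e e) * nrm a * nrm b"
    unfolding sf_def nrm_eq_sqrt gf_def power2_norm_eq_inner[symmetric]
    by (rule convection_bound[OF fe_X_NP fe_X_N fe_X_N h1 hat_exists inv D_nonneg])
  also have "\<dots> \<le> 5 / 6 * D * (nrm f / 2) * nrm a * nrm b"
    by (intro mult_right_mono mult_left_mono elliptic(2)[OF assms]) (use D_nonneg nrm_nonneg in auto)
  finally show ?thesis by simp
qed

section \<open>One implicit step under the smallness condition\<close>

context
  fixes p :: "plane \<Rightarrow> real" and q :: "plane \<Rightarrow> plane" and \<tau> E :: real and U0 W0 U' W' :: "real ^ 'k"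
  assumes pq: "W1inf_with_gradient L p q" and \<tau>: "0 \<le> \<tau>" "\<tau> * norm_1inf L p q \<le> 1 / 6"
    and small: "\<tau> * D * E \<le> 1 - 2 * (\<tau> * norm_1inf L p q)"
    and E: "nrm W0 \<le> E" "nrm W' \<le> E"
    and st: "implicit_step L q \<phi> \<tau> U0 W0 U' W'"
begin

text \<open>\<open>u\<close> measures the effect of \<open>p\<close> over one step, and
  \<open>5 / 12 * w\<close> that of convection with a transported function of norm at most
  \<open>E\<close>.\<close>

abbreviation (input) "u \<equiv> \<tau> * norm_1inf L p q"
abbreviation (input) "w \<equiv> \<tau> * D * E"

lemma small_constants:
  shows "0 \<le> u" "0 \<le> w" "0 < 1 - u - 5 / 12 * w"
    "3 * (5 / 12) * w * (u + 5 / 12 * w) \<le> 9 / 10 * (1 - u - 5 / 12 * w)"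
proof -
  show u: "0 \<le> u" using \<tau>(1) norm_1inf_nonneg[OF pq] by simp
  have "0 \<le> E" using E(1) nrm_nonneg[of W0] by linarith
  then show w: "0 \<le> w" using \<tau>(1) D_nonneg by simp
  show "0 < 1 - u - 5 / 12 * w" "3 * (5 / 12) * w * (u + 5 / 12 * w) \<le> 9 / 10 * (1 - u - 5 / 12 * w)"
    using contraction_arith[OF u \<tau>(2) w small] by simp_all
qed

lemma step_elliptic: "K_mat L \<phi> *v U0 = M_mat L \<phi> *v W0" "K_mat L \<phi> *v U' = M_mat L \<phi> *v W'"
  using st by (simp_all add: implicit_step_def)

lemma elliptic_diff:
  assumes "K_mat L \<phi> *v a = M_mat L \<phi> *v b" "K_mat L \<phi> *v a' = M_mat L \<phi> *v b'"
  shows "K_mat L \<phi> *v (a - a') = M_mat L \<phi> *v (b - b')"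
  using assms by (simp add: matrix_vector_mult_diff_distrib)

lemmas sf_diff1 = linear_diff[OF linear_sf1] and sf_diff3 = linear_diff[OF linear_sf3]
  and rf_diff1 = linear_diff[OF linear_rf1[OF pq]] and mf_diff2 = linear_diff[OF linear_mf2]

text \<open>The bound \<open>B\<close> is kept separate so that it can be \<open>E\<close> for a
  solution and the norm itself for an error or an increment.\<close>

lemma tau_sf_le:
  assumes "K_mat L \<phi> *v e = M_mat L \<phi> *v f" "nrm b \<le> B"
  shows "\<tau> * sf e a b \<le> 5 / 12 * (\<tau> * D * B) * nrm f * nrm a"
proof -
  have "\<tau> * sf e a b \<le> \<tau> * (5 / 12 * D * nrm f * nrm a * nrm b)"
    using sf_elliptic[OF assms(1), of a b] \<tau>(1) by (intro mult_left_mono) auto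
  also have "\<dots> \<le> \<tau> * (5 / 12 * D * nrm f * nrm a * B)"
    using \<tau>(1) assms(2) D_nonneg nrm_nonneg by (intro mult_left_mono) auto
  finally show ?thesis by (simp add: mult_ac)
qed

lemma tau_rf_le:
  assumes "K_mat L \<phi> *v e = M_mat L \<phi> *v f"
  shows "\<tau> * rf q e a \<le> u * nrm f * nrm a"
proof -
  have "\<tau> * rf q e a \<le> \<tau> * (norm_1inf L p q * nrm f * nrm a)"
    using rf_elliptic[OF pq assms, of a] \<tau>(1) by (intro mult_left_mono) auto
  then show ?thesis by (simp add: mult.assoc)
qed

lemma implicit_unique:
  assumes st2: "implicit_step L q \<phi> \<tau> U0 W0 U2 W2"
  shows "U2 = U' \<and> W2 = W'"
proof -
  have K: "K_mat L \<phi> *v (U2 - U') = M_mat L \<phi> *v (W2 - W')"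
    using st2 step_elliptic(2) by (intro elliptic_diff) (simp_all add: implicit_step_def)
  define f where "f = W2 - W'"
  \<comment> \<open>The difference of the products is split so that \<open>U2\<close> meets
    \<open>f\<close> twice and drops out by skew symmetry. The other convection term involves only
    \<open>W'\<close>, which is bounded by \<open>E\<close>.\<close>
  have "mf f f = \<tau> * sf U2 f f + \<tau> * sf (U2 - U') f W' + \<tau> * rf q (U2 - U') f"
    using implicit_test[OF pq st2, of f] implicit_test[OF pq st, of f]
    by (simp add: f_def mf_diff2 sf_diff1 sf_diff3 rf_diff1 algebra_simps)
  also have "\<dots> \<le> 5 / 12 * w * nrm f * nrm f + u * nrm f * nrm f"
    using tau_sf_le[OF K E(2), of f] tau_rf_le[OF K, of f] by (simp add: sf_skew f_def)
  finally have "(1 - u - 5 / 12 * w) * (nrm f)\<^sup>2 \<le> 0"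
    by (simp add: nrm_sq[symmetric] power2_eq_square algebra_simps)
  then have "(nrm f)\<^sup>2 \<le> 0" using small_constants(3) by (simp add: mult_le_0_iff)
  then have "nrm f = 0" by simp
  then have "nrm (U2 - U') = 0"
    using elliptic(1)[OF K] nrm_nonneg[of "U2 - U'"] by (simp add: f_def)
  then show ?thesis using nrm_zero[of f] nrm_zero[of "U2 - U'"] \<open>nrm f = 0\<close> by (simp add: f_def)
qed

text \<open>Testing with the increment itself. As the iteration starts at \<open>W0\<close>, this is
  a bound for the initial error.\<close>

lemma implicit_increment: "nrm (W' - W0) \<le> (u + 5 / 12 * w) * E"
proof -
  define f where "f = W' - W0"
  have "nrm f * nrm f = \<tau> * sf U' f W' + \<tau> * rf q U' f"
    using implicit_test[OF pq st, of f] by (simp add: power2_eq_square[symmetric] nrm_sq f_def mf_diff2)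
  also have "\<dots> \<le> 5 / 12 * w * nrm W' * nrm f + u * nrm W' * nrm f"
    by (intro add_mono tau_sf_le tau_rf_le step_elliptic E)
  also have "\<dots> = (5 / 12 * w + u) * nrm f * nrm W'" by (simp add: algebra_simps)
  also have "\<dots> \<le> (5 / 12 * w + u) * nrm f * E"
    using small_constants nrm_nonneg by (intro mult_left_mono E) auto
  finally have *: "nrm f * nrm f \<le> nrm f * ((u + 5 / 12 * w) * E)" by (simp add: algebra_simps)
  have "0 \<le> (u + 5 / 12 * w) * E"
    using small_constants E(1) nrm_nonneg[of W0] by (intro mult_nonneg_nonneg) auto
  then show ?thesis using * nrm_nonneg[of f] by (cases "nrm f = 0") (auto simp: f_def)
qed

section \<open>Errors of the chord iterates\<close>

context
  fixes Uc Wc :: "nat \<Rightarrow> real ^ 'k"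
  assumes chord: "chord_iterates L q \<phi> \<tau> U0 W0 Uc Wc"
begin

text \<open>For successors this is the lower block row; for index 0 it is the elliptic equation at
  the old time.\<close>

lemma chord_elliptic: "K_mat L \<phi> *v Uc k = M_mat L \<phi> *v Wc k"
proof (cases k)
  case 0
  then show ?thesis using chord step_elliptic(1) by (simp add: chord_iterates_def)
next
  case (Suc j)
  have "K_mat L \<phi> *v Uc (Suc j) + (- M_mat L \<phi>) *v Wc (Suc j) = 0"
    using chord unfolding chord_iterates_def block_mult_vec block_vec_inject by blast
  moreover have "(- M_mat L \<phi>) *v Wc (Suc j) = - (M_mat L \<phi> *v Wc (Suc j))"
    by (simp add: vec_eq_iff matrix_vector_mult_def sum_negf)
  ultimately show ?thesis using Suc by simp
qed

lemma chord_test: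
  "mf a (Wc (Suc k)) - \<tau> * sf (Uc (Suc k)) a W0 - \<tau> * sf U0 a (Wc (Suc k)) - \<tau> * rf q (Uc (Suc k)) a =
   mf a W0 - \<tau> * sf (Uc k) a W0 - \<tau> * sf U0 a (Wc k) + \<tau> * sf (Uc k) a (Wc k)"
proof -
  have 0: "Uc 0 = U0" "Wc 0 = W0" using chord by (simp_all add: chord_iterates_def)
  have "(\<tau> *\<^sub>R B_mat L \<phi> W0 - \<tau> *\<^sub>R R_mat L q \<phi>) *v Uc (Suc k) + (M_mat L \<phi> + \<tau> *\<^sub>R S_mat L \<phi> U0) *v Wc (Suc k) =
    \<tau> *\<^sub>R (S_mat L \<phi> (Uc k) *v W0) + \<tau> *\<^sub>R (S_mat L \<phi> U0 *v Wc k)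
      - \<tau> *\<^sub>R (S_mat L \<phi> (Uc k) *v Wc k) + M_mat L \<phi> *v W0" (is "?l = ?r")
    using chord unfolding chord_iterates_def block_mult_vec block_vec_inject 0 by blast
  then have "a \<bullet> ?l = a \<bullet> ?r" by simp
  then show ?thesis
    by (simp add: matrix_vector_mult_add_rdistrib matrix_vector_mult_diff_rdistrib scaleR_matrix_vector_assoc[symmetric]
        B_mat_mult inner_add_right inner_diff_right inner_M inner_S inner_R[OF pq] algebra_simps)
qed

text \<open>The terms linear in the new error are absorbed on the left. The others are products of
  the old error with \<open>W' - W0\<close> or with \<open>Wc k - W0\<close>; the triangle
  inequality for the latter yields \<open>2 * nrm (W' - W0) + N k\<close>.\<close>

lemma chord_error:
  defines "N \<equiv> \<lambda>k. nrm (Wc k - W')"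
  shows "N (Suc k) * (1 - u - 5 / 12 * w) \<le> 5 / 12 * (\<tau> * D * (2 * nrm (W' - W0) + N k)) * N k"
proof (cases "N (Suc k) = 0")
  case True
  have "0 \<le> 5 / 12 * (\<tau> * D * (2 * nrm (W' - W0) + N k)) * N k"
    unfolding N_def using \<tau>(1) D_nonneg nrm_nonneg by (intro mult_nonneg_nonneg add_nonneg_nonneg) auto
  then show ?thesis using True by simp
next
  case False
  then have pos: "0 < N (Suc k)" using nrm_nonneg[of "Wc (Suc k) - W'"] by (simp add: N_def)
  define f where "f = Wc (Suc k) - W'"
  define g where "g = Wc k - W'"
  let ?e = "Uc (Suc k) - U'" and ?ek = "Uc k - U'"
  have Ke: "K_mat L \<phi> *v ?e = M_mat L \<phi> *v f" and Kek: "K_mat L \<phi> *v ?ek = M_mat L \<phi> *v g"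
    and K0: "K_mat L \<phi> *v (Uc k - U0) = M_mat L \<phi> *v (Wc k - W0)"
    unfolding f_def g_def by (intro elliptic_diff chord_elliptic step_elliptic)+
  have Nf: "N (Suc k) = nrm f" and Ng: "N k = nrm g" by (simp_all add: N_def f_def g_def)
  have dist0: "nrm (Wc k - W0) \<le> nrm g + nrm (W' - W0)"
    using nrm_triangle[of g "W' - W0"] by (simp add: g_def)
  \<comment> \<open>The two equations are subtracted and expanded around \<open>(U0, W0)\<close>.
    The third term vanishes by skew symmetry, and the last two are the remainder of the
    linearisation.\<close>
  have "mf f f = \<tau> * rf q ?e f + \<tau> * sf ?e f W0 + \<tau> * sf U0 f f + \<tau> * sf ?ek f (W' - W0) + \<tau> * sf (Uc k - U0) f g"
    using chord_test[of f k] implicit_test[OF pq st, of f]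
    by (simp add: f_def g_def mf_diff2 sf_diff1 sf_diff3 rf_diff1 algebra_simps)
  also have "\<dots> \<le> u * nrm f * nrm f + 5 / 12 * w * nrm f * nrm f + 0
      + 5 / 12 * (\<tau> * D * nrm (W' - W0)) * nrm g * nrm f
      + 5 / 12 * (\<tau> * D * nrm g) * nrm (Wc k - W0) * nrm f"
    by (intro add_mono tau_rf_le tau_sf_le Ke Kek K0 E) (simp_all add: sf_skew)
  also have "\<dots> \<le> u * nrm f * nrm f + 5 / 12 * w * nrm f * nrm f + 0
      + 5 / 12 * (\<tau> * D * nrm (W' - W0)) * nrm g * nrm f
      + 5 / 12 * (\<tau> * D * nrm g) * (nrm g + nrm (W' - W0)) * nrm f"
    by (intro add_left_mono mult_right_mono mult_left_mono dist0) (use \<tau>(1) D_nonneg nrm_nonneg in auto)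
  also have "\<dots> = (u + 5 / 12 * w) * (nrm f * nrm f) + nrm f * (5 / 12 * (\<tau> * D * (2 * nrm (W' - W0) + nrm g)) * nrm g)"
    by (simp add: field_simps)
  finally have "nrm f * nrm f - (u + 5 / 12 * w) * (nrm f * nrm f) \<le>
      nrm f * (5 / 12 * (\<tau> * D * (2 * nrm (W' - W0) + nrm g)) * nrm g)"
    unfolding nrm_sq[symmetric] power2_eq_square by linarith
  moreover have "nrm f * nrm f - (u + 5 / 12 * w) * (nrm f * nrm f) = nrm f * (nrm f * (1 - u - 5 / 12 * w))"
    by (simp add: field_simps)
  ultimately have "nrm f * (nrm f * (1 - u - 5 / 12 * w)) \<le> nrm f * (5 / 12 * (\<tau> * D * (2 * nrm (W' - W0) + nrm g)) * nrm g)"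
    by linarith
  then show ?thesis using pos unfolding Nf Ng by (rule mult_left_le_imp_le)
qed

text \<open>The induction hypothesis keeps the error below the initial one, so the bracket in
  \<open>chord_error\<close> is at most three increments. \<open>small_constants\<close> turns this
  into the factor \<open>9 / 10\<close>.\<close>

lemma chord_contraction:
  "nrm (Wc k - W') \<le> (9 / 10) ^ k * nrm (W' - W0)"
proof (induction k)
  case 0
  then show ?case using chord by (simp add: chord_iterates_def nrm_minus)
next
  case (Suc k)
  let ?N = "nrm (Wc k - W')" and ?\<Delta> = "nrm (W' - W0)" and ?c = "1 - u - 5 / 12 * w"
  have le: "?N \<le> ?\<Delta>"
  proof -
    have "(9 / 10 :: real) ^ k * ?\<Delta> \<le> 1 * ?\<Delta>" by (intro mult_right_mono power_le_one nrm_nonneg) auto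
    then show ?thesis using Suc by simp
  qed
  have "nrm (Wc (Suc k) - W') * ?c \<le> 5 / 12 * (\<tau> * D * (2 * ?\<Delta> + ?N)) * ?N" by (rule chord_error)
  also have "\<dots> \<le> 5 / 12 * (\<tau> * D * (3 * ((u + 5 / 12 * w) * E))) * ?N"
    using le implicit_increment \<tau>(1) D_nonneg nrm_nonneg
    by (intro mult_right_mono mult_left_mono) auto
  also have "\<dots> = 3 * (5 / 12) * w * (u + 5 / 12 * w) * ?N" by (simp add: mult_ac)
  also have "\<dots> \<le> 9 / 10 * ?c * ?N" by (intro mult_right_mono small_constants nrm_nonneg)
  finally have "?c * nrm (Wc (Suc k) - W') \<le> ?c * (9 / 10 * ?N)" by (simp only: mult_ac)
  then have "nrm (Wc (Suc k) - W') \<le> 9 / 10 * ?N" using small_constants(3) by (rule mult_left_le_imp_le)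
  also have "\<dots> \<le> 9 / 10 * ((9 / 10) ^ k * ?\<Delta>)" using Suc by simp
  finally show ?case by simp
qed

text \<open>The second limit follows from the geometric bound; the first is dominated by it, since
  an elliptic potential has no larger norm than its datum.\<close>

lemma chord_converges:
  "(\<lambda>k. nrm (Uc k - U')) \<longlonglongrightarrow> 0" "(\<lambda>k. nrm (Wc k - W')) \<longlonglongrightarrow> 0"
proof -
  have "(\<lambda>k. (9 / 10 :: real) ^ k * nrm (W' - W0)) \<longlonglongrightarrow> 0 * nrm (W' - W0)"
    by (intro tendsto_intros LIMSEQ_power_zero) simp
  then have lim: "(\<lambda>k. (9 / 10 :: real) ^ k * nrm (W' - W0)) \<longlonglongrightarrow> 0" by simp
  show W: "(\<lambda>k. nrm (Wc k - W')) \<longlonglongrightarrow> 0"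
    by (rule real_tendsto_sandwich[OF _ _ tendsto_const lim]) (simp_all add: nrm_nonneg chord_contraction)
  have "nrm (Uc k - U') \<le> nrm (Wc k - W')" for k
    by (intro elliptic(1) elliptic_diff chord_elliptic step_elliptic)
  then show "(\<lambda>k. nrm (Uc k - U')) \<longlonglongrightarrow> 0"
    by (intro real_tendsto_sandwich[OF _ _ tendsto_const W]) (simp_all add: nrm_nonneg)
qed

end

end

end

end

theorem theorem4p2:
  fixes L T h \<tau> c0_inv c_inv c1 \<epsilon>1 \<epsilon>2 D2 :: real
    and n m :: nat
    and x y :: "nat \<Rightarrow> real"
    and d :: "nat \<Rightarrow> nat \<Rightarrow> bool"
    and \<T> :: "plane set set"
    and \<nu> :: "'k::finite \<Rightarrow> nat \<times> nat"
    and \<phi> :: "'k \<Rightarrow> plane \<Rightarrow> real"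
    and p u0 lap_u0 w0 :: "plane \<Rightarrow> real"
    and q :: "plane \<Rightarrow> plane"
    and U W Uc Wc :: "nat \<Rightarrow> real ^ 'k"
  assumes "L > 0" and "T > 0"
    and p: "W1inf_with_gradient L p q"
    and u0: "u0 \<in> H2_space L \<inter> H1P_space L"
    and lap: "weak_laplacian (Omega L) u0 lap_u0"
    and w0: "w0 \<in> L2_space L" "AE z in lebesgue_on (Omega L). w0 z = u0 z - lap_u0 z"
    and grid: "grid_points L n x" "grid_points L n y"
    and tri: "\<T> = grid_triangulation n x y d"
    and h: "h = mesh_size \<T>"
    and basis: "nodal_basis L n x y \<T> \<nu> \<phi>"
    and c0_inv: "c0_inv > 0" "\<forall>v\<in>X_N L \<T>. normH1 L v \<le> c0_inv / h * norm2 L v"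
    and c_inv: "c_inv > 0" "\<forall>v\<in>X_N L \<T>. seminorm_14 L v \<le> c_inv * h powr (- 5 / 4) * norm2 L v"
    and time: "real (Suc m) * \<tau> \<le> T"
    and sol: "implicit_solution L q \<T> \<phi> \<tau> w0 (Suc m) U W"
    and chord: "chord_iterates L q \<phi> \<tau> (U m) (W m) Uc Wc"
    and pos: "c1 > 0" "\<epsilon>1 > 0" "\<epsilon>2 > 0"
    and start: "norm2 L (\<lambda>z. fe_fun \<phi> (U (Suc m)) z - fe_fun \<phi> (Uc 0) z) < c1"
    and incr: "\<exists>k0. \<forall>k\<ge>k0.
        norm2 L (\<lambda>z. fe_fun \<phi> (Uc (Suc k)) z - fe_fun \<phi> (Uc k) z) < \<epsilon>1 \<and>
        norm2 L (\<lambda>z. fe_fun \<phi> (Wc (Suc k)) z - fe_fun \<phi> (Wc k) z) < \<epsilon>2"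
    and D2: "D2 = c_inv\<^sup>2 * (4 * c1 + \<epsilon>1 + \<epsilon>2 + exp (3 * T * norm_1inf L p q) * norm2 L w0)
                  + 2 * norm_1inf L p q"
    and "h < 1"
    and "0 < \<tau>"
    and tau: "ereal \<tau> \<le> Min {1 / ereal (6 * norm_1inf L p q),
                             ereal (h\<^sup>2) / ereal (16 * c0_inv * norm_M (M_mat L \<phi>) (W m)),
                             ereal (h powr (5 / 2) / D2)}"
  shows "(\<forall>U' W'. implicit_step L q \<phi> \<tau> (U m) (W m) U' W' \<longrightarrow> U' = U (Suc m) \<and> W' = W (Suc m)) \<and>
         (\<lambda>k. norm2 L (\<lambda>z. fe_fun \<phi> (Uc k) z - fe_fun \<phi> (U (Suc m)) z)) \<longlonglongrightarrow> 0 \<and>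
         (\<lambda>k. norm2 L (\<lambda>z. fe_fun \<phi> (Wc k) z - fe_fun \<phi> (W (Suc m)) z)) \<longlonglongrightarrow> 0"
proof -
  interpret fe_space L n x y d \<nu> \<phi>
    by unfold_locales (use assms in auto)
  let ?P = "norm_1inf L p q" and ?A = "c_inv * h powr (- 5 / 4)"
  let ?D = "c_inv\<^sup>2 * h powr (- 5 / 2)" and ?E = "exp (3 * T * norm_1inf L p q) * norm2 L w0"
  have h_pos: "0 < h" using mesh_size_pos by (simp add: h tri)
  have P: "0 \<le> ?P" by (rule norm_1inf_nonneg[OF p])
  have E0: "0 \<le> ?E" by (simp add: norm2_def ip2_def)
  have D: "?D = ?A\<^sup>2"
    by (simp add: power2_eq_square powr_add[symmetric] mult_ac)
  \<comment> \<open>The inverse inequality is raised to the fourth power, which removes the root in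
    \<open>seminorm_14\<close>.\<close>
  have inv: "(LINT z|lebesgue_on (Omega L). norm (grad v z) ^ 4) \<le> ?D\<^sup>2 * (LINT z|lebesgue_on (Omega L). (v z)\<^sup>2)\<^sup>2"
    if v: "v \<in> X_N L \<T>" for v
  proof -
    let ?X = "LINT z|lebesgue_on (Omega L). norm (grad v z) ^ 4" and ?Y = "LINT z|lebesgue_on (Omega L). (v z)\<^sup>2"
    have "0 \<le> ?X" "0 \<le> ?Y" by simp_all
    have "?X = seminorm_14 L v ^ 4" unfolding seminorm_14_def using \<open>0 \<le> ?X\<close> by simp
    also have "\<dots> \<le> (?A * norm2 L v) ^ 4"
      using c_inv(2) v \<open>0 \<le> ?X\<close> by (intro power_mono) (auto simp: seminorm_14_def)
    also have "\<dots> = (?A\<^sup>2)\<^sup>2 * ((norm2 L v)\<^sup>2)\<^sup>2" by (simp add: power_mult_distrib)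
    also have "(norm2 L v)\<^sup>2 = ?Y" using \<open>0 \<le> ?Y\<close> by (simp add: norm2_def ip2_def power2_eq_square[symmetric])
    finally show ?thesis unfolding D .
  qed
  have D2_pos: "0 < D2"
  proof -
    have "0 < c_inv\<^sup>2 * (4 * c1 + \<epsilon>1 + \<epsilon>2 + ?E)" using c_inv(1) pos E0 by (intro mult_pos_pos) auto
    then show ?thesis using P by (simp add: D2)
  qed
  have \<tau>_le: "ereal \<tau> \<le> 1 / ereal (6 * ?P)" "ereal \<tau> \<le> ereal (h powr (5 / 2) / D2)"
    using tau by simp_all
  \<comment> \<open>If \<open>?P\<close> is zero, the restriction on \<open>\<tau>\<close> reads as
    an infinite bound and the claim is trivial.\<close>
  have u6: "\<tau> * ?P \<le> 1 / 6"
  proof (cases "?P = 0")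
    case False
    then have "0 < ?P" using P by simp
    then have "\<tau> \<le> 1 / (6 * ?P)" using \<tau>_le(1) by (simp add: one_ereal_def)
    then show ?thesis using \<open>0 < ?P\<close> by (simp add: field_simps)
  qed simp
  have small: "\<tau> * ?D * ?E \<le> 1 - 2 * (\<tau> * ?P)"
  proof -
    have "\<tau> * D2 \<le> h powr (5 / 2)" using \<tau>_le(2) D2_pos by (simp add: field_simps)
    moreover have "c_inv\<^sup>2 * ?E + 2 * ?P \<le> D2"
      using pos unfolding D2 by (intro add_mono mult_left_mono) auto
    ultimately have "\<tau> * (c_inv\<^sup>2 * ?E + 2 * ?P) \<le> h powr (5 / 2)"
      using mult_left_mono[of "c_inv\<^sup>2 * ?E + 2 * ?P" D2 \<tau>] \<open>0 < \<tau>\<close> by linarith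
    then have "\<tau> * (c_inv\<^sup>2 * ?E + 2 * ?P) * h powr (- 5 / 2) \<le> h powr (5 / 2) * h powr (- 5 / 2)"
      by (rule mult_right_mono) simp
    also have "\<dots> = 1" using h_pos by (simp add: powr_add[symmetric])
    finally have "\<tau> * ?D * ?E + 2 * (\<tau> * ?P) * h powr (- 5 / 2) \<le> 1" by (simp add: algebra_simps)
    \<comment> \<open>Here \<open>h < 1\<close> enters: the negative power of \<open>h\<close> is at
      least 1 and may be dropped from the term with \<open>?P\<close>.\<close>
    moreover have "2 * (\<tau> * ?P) * 1 \<le> 2 * (\<tau> * ?P) * h powr (- 5 / 2)"
    proof (rule mult_left_mono)
      have "h powr 0 \<le> h powr (- 5 / 2)" using h_pos \<open>h < 1\<close> by (intro powr_mono') auto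
      then show "1 \<le> h powr (- 5 / 2)" using h_pos by simp
    qed (use P \<open>0 < \<tau>\<close> in simp)
    ultimately show ?thesis by linarith
  qed
  have E: "nrm (W j) \<le> ?E" if "j \<le> Suc m" for j
  proof -
    have "nrm (W j) \<le> exp (3 * (real j * (\<tau> * ?P))) * norm2 L w0"
      using implicit_exp_bound[OF p sol[unfolded tri] w0(1) _ u6 that] \<open>0 < \<tau>\<close> by simp
    also have "\<dots> \<le> ?E"
    proof (rule mult_right_mono)
      \<comment> \<open>All times up to the end of the present step are at most \<open>T\<close>, so
        one constant bounds both the old and the new solution.\<close>
      have "real j * \<tau> \<le> real (Suc m) * \<tau>" using that \<open>0 < \<tau>\<close> by (intro mult_right_mono) auto
      then have "real j * \<tau> \<le> T" using time by linarith
      then have "real j * \<tau> * ?P \<le> T * ?P" using P by (rule mult_right_mono)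
      then show "exp (3 * (real j * (\<tau> * ?P))) \<le> exp (3 * T * ?P)" by (simp add: mult_ac)
    qed (simp add: norm2_def ip2_def)
    finally show ?thesis .
  qed
  have st: "implicit_step L q \<phi> \<tau> (U m) (W m) (U (Suc m)) (W (Suc m))"
    using sol by (simp add: implicit_solution_def)
  have h1: "mesh_size \<T> < 1" using \<open>h < 1\<close> by (simp add: h tri)
  have D0: "0 \<le> ?D" and \<tau>0: "0 \<le> \<tau>" using \<open>0 < \<tau>\<close> by simp_all
  have uniq: "U' = U (Suc m) \<and> W' = W (Suc m)" if "implicit_step L q \<phi> \<tau> (U m) (W m) U' W'" for U' W'
    by (rule implicit_unique[OF h1[unfolded tri] D0 inv[unfolded tri] p \<tau>0 u6 small E E st that]) simp_all
  have "(\<lambda>k. nrm (Uc k - U (Suc m))) \<longlonglongrightarrow> 0"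
    by (rule chord_converges(1)[OF h1[unfolded tri] D0 inv[unfolded tri] p \<tau>0 u6 small E E st chord]) simp_all
  moreover have "(\<lambda>k. nrm (Wc k - W (Suc m))) \<longlonglongrightarrow> 0"
    by (rule chord_converges(2)[OF h1[unfolded tri] D0 inv[unfolded tri] p \<tau>0 u6 small E E st chord]) simp_all
  moreover have "nrm (a - b) = norm2 L (\<lambda>z. fe_fun \<phi> a z - fe_fun \<phi> b z)" for a b
    unfolding nrm_def by (simp add: fe_diff[abs_def])
  ultimately show ?thesis using uniq by auto
qed

end
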